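(* Let $d,k,t\in\mathbb{Z}_+$ with $k\le\sqrt d$, let $0<\epsilon=(O(t))^{-t}$, $0\le C<1/2000$, $0<c<1$, and $\delta=C\epsilon^{1-1/t}/t$. Let $\mathcal{A}$ be an SQ algorithm that, given access to any distribution of the form $(1-\epsilon)P+\epsilon B$ where $P\in\mathcal{P}_{k,t}$ and $B$ is arbitrary, is guaranteed to find a vector $\hat\mu$ with $\|\hat\mu-\mathbb{E}_{X\sim P}[X]\|_2\le\delta$. Then $\mathcal{A}$ either makes $\Omega(d^{ck^c/8}k^{-(t+1)(1-c)})$ queries, or makes at least one query with tolerance $O\big(k^{-(t+1)(1/2-c/2)}2^{(t/2+1)}e^{O(\delta^2/\epsilon^2)}\big)$.
   Context: SQ model: a statistical query is a bounded function $f:\mathbb{R}^d\to[-1,1]$; the oracle $\mathrm{STAT}(\tau)$ for a distribution $D$ answers with some value $v$ satisfying $|v-\mathbb{E}_{X\sim D}[f(X)]|\le\tau$ ($\tau$ is the tolerance); an SQ algorithm accesses the distribution only through adaptive such queries. $\mathcal{P}_{k,t}$ is the class of distributions $P$ on $\mathbb{R}^d$ such that: (1) the mean $\mu$ of $P$ is $k$-sparse with $\|\mu\|_2\le1$; (2) $P$ has subgaussian tails: for an absolute constant $c'$, all unit $v$ and all $i\in\mathbb{N}$, $(\mathbb{E}_{X\sim P}|v^T(X-\mu)|^i)^{1/i}\le c'\sqrt i$; (3) for a large absolute constant $C_0$ there is an SoS proof $\{\|v\|_2^2=1\}\vdash_{O(t)}^{v}\mathbb{E}_{X\sim P}[\langle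 X-\mu,v\rangle^t]^2\le(C_0t)^t$. Here an SoS proof of degree $\ell$ of $r\ge0$ from axioms is an identity expressing $r$ as a sum of terms (sum-of-squares polynomial)$\times$(product of axiom polynomials), each term of degree at most $\ell$. The condition $\epsilon=(O(t))^{-t}$ means $\epsilon$ is at most $(C_1t)^{-t}$ for a suitable absolute constant $C_1$. *)

theory Defs
  imports "HOL-Probability.Probability"
begin

definition Rd :: "nat \<Rightarrow> (nat \<Rightarrow> real) measure" where
  "Rd d = PiM {..<d} (\<lambda>_. borel :: real measure)"

definition ip :: "nat \<Rightarrow> (nat \<Rightarrow> real) \<Rightarrow> (nat \<Rightarrow> real) \<Rightarrow> real" where
  "ip d u v = (\<Sum>i<d. u i * v i)"

definition vnorm :: "nat \<Rightarrow> (nat \<Rightarrow> real) \<Rightarrow> real" where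
  "vnorm d u = sqrt (\<Sum>i<d. (u i)\<^sup>2)"

definition distr_on :: "nat \<Rightarrow> (nat \<Rightarrow> real) measure \<Rightarrow> bool" where
  "distr_on d P \<longleftrightarrow> prob_space P \<and> sets P = sets (Rd d)"

definition mean_vec :: "nat \<Rightarrow> (nat \<Rightarrow> real) measure \<Rightarrow> (nat \<Rightarrow> real)" where
  "mean_vec d P = (\<lambda>i. if i < d then (\<integral>x. x i \<partial>P) else 0)"

definition mixture :: "real \<Rightarrow> 'a measure \<Rightarrow> 'a measure \<Rightarrow> 'a measure" where
  "mixture eps P B = measure_of (space P) (sets P)
     (\<lambda>A. ennreal (1 - eps) * emeasure P A + ennreal eps * emeasure B A)"

definition poly_fun :: "nat \<Rightarrow> nat \<Rightarrow> ((nat \<Rightarrow> real) \<Rightarrow> real) \<Rightarrow> bool" where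
  "poly_fun d n p \<longleftrightarrow>
     (\<exists>S coef. finite S \<and>
        (\<forall>a\<in>S. (\<forall>i\<ge>d. a i = (0::nat)) \<and> (\<Sum>i<d. a i) \<le> n) \<and>
        (\<forall>v. p v = (\<Sum>a\<in>S. coef a * (\<Prod>i<d. v i ^ a i))))"

text \<open>An SoS proof of degree l (in the variables v) of r >= 0 from the axiom
  ||v||^2 = 1, i.e. from the axiom polynomials ||v||^2 - 1 >= 0 and 1 - ||v||^2 >= 0:
  r is a sum of terms (SoS polynomial) * (product of axiom polynomials), each term of
  degree at most l. A term is encoded as (ps, m, s): SoS polynomial sum of p^2 over p in ps,
  times (s * (||v||^2 - 1))^m with s = 1 or s = -1.\<close>
definition sos_proof :: "nat \<Rightarrow> nat \<Rightarrow> ((nat \<Rightarrow> real) \<Rightarrow> real) \<Rightarrow> bool" where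
  "sos_proof d l r \<longleftrightarrow>
     (\<exists>terms :: (((nat \<Rightarrow> real) \<Rightarrow> real) list \<times> nat \<times> real) list.
        (\<forall>(ps, m, s) \<in> set terms.
            2 * m \<le> l \<and> (s = 1 \<or> s = -1) \<and>
            (\<forall>p\<in>set ps. poly_fun d ((l - 2 * m) div 2) p)) \<and>
        (\<forall>v. r v = (\<Sum>(ps, m, s) \<leftarrow> terms.
                      (\<Sum>p\<leftarrow>ps. (p v)\<^sup>2) * (s * ((\<Sum>i<d. (v i)\<^sup>2) - 1)) ^ m)))"

text \<open>Parameters: cp is the subgaussian constant c', C0 the SoS moment constant, and
  Dg the constant in the SoS degree bound O(t) (degree at most Dg * t).\<close>
definition class_P :: "real \<Rightarrow> real \<Rightarrow> nat \<Rightarrow> nat \<Rightarrow> nat \<Rightarrow> nat \<Rightarrow>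
    (nat \<Rightarrow> real) measure \<Rightarrow> bool" where
  "class_P cp C0 Dg d k t P \<longleftrightarrow>
     distr_on d P \<and>
     (\<forall>i<d. integrable P (\<lambda>x. x i)) \<and>
     card {i. i < d \<and> mean_vec d P i \<noteq> 0} \<le> k \<and>
     vnorm d (mean_vec d P) \<le> 1 \<and>
     (\<forall>v. vnorm d v = 1 \<longrightarrow> (\<forall>i::nat. i \<ge> 1 \<longrightarrow>
         integrable P (\<lambda>x. \<bar>ip d v (\<lambda>j. x j - mean_vec d P j)\<bar> ^ i) \<and>
         root i (\<integral>x. \<bar>ip d v (\<lambda>j. x j - mean_vec d P j)\<bar> ^ i \<partial>P) \<le> cp * sqrt (real i))) \<and>
     sos_proof d (Dg * t)
       (\<lambda>v. (C0 * real t) ^ t - (\<integral>x. (ip d (\<lambda>j. x j - mean_vec d P j) v) ^ t \<partial>P)\<^sup>2)"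

text \<open>A (deterministic, adaptive) SQ algorithm maps the list of answers received so far
  to its next action: either a query (f, tau) or an output vector.\<close>
datatype sq_action = Query "(nat \<Rightarrow> real) \<Rightarrow> real" real | Output "nat \<Rightarrow> real"

type_synonym sq_alg = "real list \<Rightarrow> sq_action"

definition wf_sq_alg :: "nat \<Rightarrow> sq_alg \<Rightarrow> bool" where
  "wf_sq_alg d A \<longleftrightarrow>
     (\<forall>hs f tau. A hs = Query f tau \<longrightarrow>
        f \<in> borel_measurable (Rd d) \<and> (\<forall>x\<in>space (Rd d). \<bar>f x\<bar> \<le> 1))"

text \<open>A transcript of answers that a STAT oracle for D may give to A: each answer
  is within the tolerance of the query asked at that point.\<close>
definition valid_run :: "sq_alg \<Rightarrow> (nat \<Rightarrow> real) measure \<Rightarrow> real list \<Rightarrow> bool" where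
  "valid_run A D hs \<longleftrightarrow>
     (\<forall>j < length hs. \<exists>f tau. A (take j hs) = Query f tau \<and>
        \<bar>hs ! j - (\<integral>x. f x \<partial>D)\<bar> \<le> tau)"

definition solves :: "real \<Rightarrow> real \<Rightarrow> nat \<Rightarrow> nat \<Rightarrow> nat \<Rightarrow> nat \<Rightarrow> real \<Rightarrow> real \<Rightarrow> sq_alg \<Rightarrow> bool" where
  "solves cp C0 Dg d k t eps delta A \<longleftrightarrow>
     (\<forall>P B hs mu. class_P cp C0 Dg d k t P \<longrightarrow> distr_on d B \<longrightarrow>
        valid_run A (mixture eps P B) hs \<longrightarrow> A hs = Output mu \<longrightarrow>
        vnorm d (\<lambda>i. mu i - mean_vec d P i) \<le> delta)"

end

theory Submission
  imports Defs
begin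

text \<open>
The reference distribution is the uniform distribution on a cube \<open>{-1, 1}\<^bsup>d \<times> N\<^esup>\<close>, where the \<open>N\<close>
signs of each of the \<open>d\<close> coordinates are added up and scaled by \<open>1 / \<surd>N\<close>. A \<open>k\<close>-subset \<open>S\<close> of the
coordinates hides the following mixture. The outliers have density \<open>\<Prod>(1 + z s / \<surd>n)\<close> over the
\<open>n = k N\<close> signs \<open>s\<close> in \<open>S\<close>, with \<open>z = 1 + 4 \<delta> / \<epsilon>\<close>. The Fourier coefficients of \<open>\<epsilon>\<close> times this
density on the levels up to \<open>t\<close> are cancelled by a real combination of the bounded functions
\<open>\<Prod>(1 + \<i> \<zeta> s / \<surd>n)\<close> with \<open>\<zeta>\<close> in \<open>{0, 1/t, ..., 1}\<close>, whose weights come from Lagrange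
interpolation. They sum up to at most \<open>1/2\<close>, so the inlier density is at most 2 and inherits
subgaussian moments with SoS proofs from the cube, while its mean has norm above \<open>2 \<delta>\<close>.

The difference between the mixture and the reference distribution has no Fourier mass on levels up
to \<open>t\<close>, so for two sets with at most \<open>k\<^sup>c\<close> common elements these differences have relative correlation
\<open>(k\<^sup>c / k)\<^bsup>t+1\<^esup>\<close>. Hence each query of large tolerance distinguishes only few sets of a large family of
such sets from the reference distribution, which is itself admissible and has mean 0.
\<close>

section \<open>Sums of squares of polynomials\<close>

lemma poly_fun_monomial:
  assumes "\<forall>i\<ge>d. a i = 0" "(\<Sum>i<d. a i) \<le> n"
  shows "poly_fun d n (\<lambda>v. c * (\<Prod>i<d. v i ^ a i))"
  unfolding poly_fun_def using assms
  by (intro exI[of _ "{a}"] exI[of _ "\<lambda>_. c"]) auto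

lemma poly_fun_add:
  assumes "poly_fun d n p" "poly_fun d n q"
  shows "poly_fun d n (\<lambda>v. p v + q v)"
proof -
  obtain S f where S: "finite S" "\<forall>a\<in>S. (\<forall>i\<ge>d. a i = (0::nat)) \<and> (\<Sum>i<d. a i) \<le> n"
    "\<forall>v. p v = (\<Sum>a\<in>S. f a * (\<Prod>i<d. v i ^ a i))"
    using assms(1) unfolding poly_fun_def by blast
  obtain T g where T: "finite T" "\<forall>a\<in>T. (\<forall>i\<ge>d. a i = (0::nat)) \<and> (\<Sum>i<d. a i) \<le> n"
    "\<forall>v. q v = (\<Sum>a\<in>T. g a * (\<Prod>i<d. v i ^ a i))"
    using assms(2) unfolding poly_fun_def by blast
  let ?h = "\<lambda>a. (if a \<in> S then f a else 0) + (if a \<in> T then g a else 0)"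
  have "p v + q v = (\<Sum>a\<in>S \<union> T. ?h a * (\<Prod>i<d. v i ^ a i))" for v
  proof -
    have "p v = (\<Sum>a\<in>S \<union> T. (if a \<in> S then f a else 0) * (\<Prod>i<d. v i ^ a i))"
      unfolding S(3)[rule_format] using S(1) T(1) by (intro sum.mono_neutral_cong_left) auto
    moreover have "q v = (\<Sum>a\<in>S \<union> T. (if a \<in> T then g a else 0) * (\<Prod>i<d. v i ^ a i))"
      unfolding T(3)[rule_format] using S(1) T(1) by (intro sum.mono_neutral_cong_left) auto
    ultimately show ?thesis by (simp add: sum.distrib distrib_right)
  qed
  then show ?thesis unfolding poly_fun_def
    using S(1,2) T(1,2) by (intro exI[of _ "S \<union> T"] exI[of _ ?h]) auto
qed

lemma poly_fun_const: "poly_fun d n (\<lambda>v. c)"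
  using poly_fun_monomial[of d "\<lambda>_. 0" n c] by simp

lemma poly_fun_sum:
  assumes "\<And>i. i \<in> I \<Longrightarrow> poly_fun d n (p i)"
  shows "poly_fun d n (\<lambda>v. \<Sum>i\<in>I. p i v)"
  using assms
  by (induction I rule: infinite_finite_induct) (auto intro: poly_fun_add poly_fun_const)

lemma poly_fun_mult:
  assumes "poly_fun d n p" "poly_fun d m q"
  shows "poly_fun d (n + m) (\<lambda>v. p v * q v)"
proof -
  obtain S f where S: "finite S" "\<forall>a\<in>S. (\<forall>i\<ge>d. a i = (0::nat)) \<and> (\<Sum>i<d. a i) \<le> n"
    "\<forall>v. p v = (\<Sum>a\<in>S. f a * (\<Prod>i<d. v i ^ a i))"
    using assms(1) unfolding poly_fun_def by blast
  obtain T g where T: "finite T" "\<forall>a\<in>T. (\<forall>i\<ge>d. a i = (0::nat)) \<and> (\<Sum>i<d. a i) \<le> m"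
    "\<forall>v. q v = (\<Sum>a\<in>T. g a * (\<Prod>i<d. v i ^ a i))"
    using assms(2) unfolding poly_fun_def by blast
  have "(\<lambda>v. p v * q v) =
      (\<lambda>v. \<Sum>a\<in>S. \<Sum>b\<in>T. (f a * g b) * (\<Prod>i<d. v i ^ (a i + b i)))"
    by (auto simp: S(3) T(3) sum_product power_add prod.distrib mult_ac fun_eq_iff
        intro!: sum.cong)
  moreover have "poly_fun d (n + m) (\<lambda>v. \<Sum>a\<in>S. \<Sum>b\<in>T. (f a * g b) * (\<Prod>i<d. v i ^ (a i + b i)))"
    using S(2) T(2)
    by (intro poly_fun_sum poly_fun_monomial) (auto simp: sum.distrib add_mono)
  ultimately show ?thesis by simp
qed

lemma poly_fun_scale: "poly_fun d n p \<Longrightarrow> poly_fun d n (\<lambda>v. c * p v)"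
  using poly_fun_mult[OF poly_fun_const[of d 0 c]] by simp

lemma poly_fun_coord: "i < d \<Longrightarrow> poly_fun d 1 (\<lambda>v. v i)"
proof -
  assume i: "i < d"
  have "(\<Prod>j<d. v j ^ (if j = i then 1 else 0)) = v i" for v :: "nat \<Rightarrow> real"
    using i prod.delta[of "{..<d}" i "\<lambda>j. v j"] by (simp add: if_distrib cong: if_cong)
  then show ?thesis
    using poly_fun_monomial[of d "\<lambda>j. if j = i then 1 else 0" 1 1] i by simp
qed

lemma poly_fun_power: "poly_fun d n p \<Longrightarrow> poly_fun d (n * m) (\<lambda>v. p v ^ m)"
  by (induction m) (auto intro: poly_fun_const poly_fun_mult)

text \<open>\<open>n\<close> bounds the degree before squaring, so a form has degree up to
  \<open>2 * n\<close> and these half-degrees add up under products. No axiom is involved yet; the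
  sphere enters in \<open>sos_proof_from_form\<close>.\<close>

definition sos_form :: "nat \<Rightarrow> nat \<Rightarrow> ((nat \<Rightarrow> real) \<Rightarrow> real) \<Rightarrow> bool" where
  "sos_form d n f \<longleftrightarrow>
     (\<exists>ps. (\<forall>p\<in>set ps. poly_fun d n p) \<and> (\<forall>v. f v = (\<Sum>p\<leftarrow>ps. (p v)\<^sup>2)))"

lemma sos_form_nonneg: "sos_form d n f \<Longrightarrow> 0 \<le> f v"
  unfolding sos_form_def by (auto intro!: sum_list_nonneg)

lemma sos_form_square: "poly_fun d n p \<Longrightarrow> sos_form d n (\<lambda>v. (p v)\<^sup>2)"
  unfolding sos_form_def by (intro exI[of _ "[p]"]) auto

lemma sos_form_const: "0 \<le> c \<Longrightarrow> sos_form d n (\<lambda>v. c)"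
  using sos_form_square[OF poly_fun_const[of d n "sqrt c"]] by simp

lemma sos_form_add:
  assumes "sos_form d n f" "sos_form d n g"
  shows "sos_form d n (\<lambda>v. f v + g v)"
proof -
  obtain ps qs where "\<forall>p\<in>set ps. poly_fun d n p" "\<forall>v. f v = (\<Sum>p\<leftarrow>ps. (p v)\<^sup>2)"
    "\<forall>p\<in>set qs. poly_fun d n p" "\<forall>v. g v = (\<Sum>p\<leftarrow>qs. (p v)\<^sup>2)"
    using assms unfolding sos_form_def by blast
  then show ?thesis
    unfolding sos_form_def by (intro exI[of _ "ps @ qs"]) auto
qed

lemma sos_form_sum:
  assumes "\<And>i. i \<in> I \<Longrightarrow> sos_form d n (f i)"
  shows "sos_form d n (\<lambda>v. \<Sum>i\<in>I. f i v)"
  using assms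
  by (induction I rule: infinite_finite_induct) (auto intro: sos_form_add sos_form_const)

lemma sos_form_mult:
  assumes "sos_form d n f" "sos_form d m g"
  shows "sos_form d (n + m) (\<lambda>v. f v * g v)"
proof -
  obtain ps qs where ps: "\<forall>p\<in>set ps. poly_fun d n p" "\<forall>v. f v = (\<Sum>p\<leftarrow>ps. (p v)\<^sup>2)"
    and qs: "\<forall>p\<in>set qs. poly_fun d m p" "\<forall>v. g v = (\<Sum>p\<leftarrow>qs. (p v)\<^sup>2)"
    using assms unfolding sos_form_def by blast
  have "f v * g v = (\<Sum>i<length ps. \<Sum>j<length qs. ((ps ! i) v * (qs ! j) v)\<^sup>2)" for v
    by (simp add: ps qs sum_list_sum_nth atLeast0LessThan sum_product power_mult_distrib)
  moreover have "sos_form d (n + m)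
      (\<lambda>v. \<Sum>i<length ps. \<Sum>j<length qs. ((ps ! i) v * (qs ! j) v)\<^sup>2)"
    using ps qs by (intro sos_form_sum sos_form_square poly_fun_mult) auto
  ultimately show ?thesis by presburger
qed

lemma sos_form_scale: "0 \<le> c \<Longrightarrow> sos_form d n f \<Longrightarrow> sos_form d n (\<lambda>v. c * f v)"
  using sos_form_mult[OF sos_form_const[of c d 0], of n f] by simp

lemma sos_form_power: "sos_form d n f \<Longrightarrow> sos_form d (n * m) (\<lambda>v. f v ^ m)"
  by (induction m) (auto intro: sos_form_const sos_form_mult)

lemma sos_form_mono: "sos_form d n f \<Longrightarrow> n \<le> m \<Longrightarrow> sos_form d m f"
  using sos_form_mult[of d n f "m - n" "\<lambda>_. 1"] sos_form_const[of 1] by simp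

text \<open>Comparisons up to sums of squares survive powers: \<open>f ^ (m + 1) - g ^ (m + 1) = f *
  (f ^ m - g ^ m) + (f - g) * g ^ m\<close>, where every factor is a sum of squares.\<close>

lemma sos_form_power_diff:
  assumes "sos_form d n (\<lambda>v. f v - g v)" "sos_form d n f" "sos_form d n g"
  shows "sos_form d (n * m) (\<lambda>v. f v ^ m - g v ^ m)"
proof (induction m)
  case 0
  then show ?case by (simp add: sos_form_const)
next
  case (Suc m)
  have "sos_form d (n + n * m) (\<lambda>v. f v * (f v ^ m - g v ^ m) + (f v - g v) * g v ^ m)"
    by (intro sos_form_add sos_form_mult assms Suc sos_form_power)
  then show ?case by (simp add: algebra_simps)
qed

lemma sos_form_norm: "sos_form d 1 (\<lambda>v. \<Sum>i<d. (v i)\<^sup>2)"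
  by (intro sos_form_sum sos_form_square poly_fun_coord) auto

lemma poly_fun_linear: "poly_fun d 1 (\<lambda>v. \<Sum>i<d. u i * v i)"
  by (intro poly_fun_sum poly_fun_scale poly_fun_coord) auto

text \<open>With \<open>b\<close> the inner product, the difference equals
  \<open>|v - b u|^2 + (1 - |u|^2) * b^2\<close>.\<close>

lemma sos_form_cauchy_schwarz:
  assumes "(\<Sum>i<d. (u i)\<^sup>2) \<le> 1"
  shows "sos_form d 1 (\<lambda>v. (\<Sum>i<d. (v i)\<^sup>2) - (\<Sum>i<d. u i * v i)\<^sup>2)"
proof -
  let ?b = "\<lambda>v :: nat \<Rightarrow> real. \<Sum>i<d. u i * v i"
  have eq: "(\<Sum>i<d. (v i)\<^sup>2) - (?b v)\<^sup>2 =
     (\<Sum>i<d. (v i + (- u i) * ?b v)\<^sup>2) + (1 - (\<Sum>i<d. (u i)\<^sup>2)) * (?b v)\<^sup>2" for v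
  proof -
    have "(\<Sum>i<d. (v i + (- u i) * ?b v)\<^sup>2) =
      (\<Sum>i<d. (v i)\<^sup>2 - 2 * ?b v * (u i * v i) + (?b v)\<^sup>2 * (u i)\<^sup>2)"
      by (intro sum.cong) (auto simp: power2_eq_square algebra_simps)
    also have "\<dots> = (\<Sum>i<d. (v i)\<^sup>2) - 2 * ?b v * ?b v + (?b v)\<^sup>2 * (\<Sum>i<d. (u i)\<^sup>2)"
      by (simp add: sum.distrib sum_subtractf sum_distrib_left)
    finally show ?thesis by (simp add: power2_eq_square algebra_simps)
  qed
  show ?thesis
    unfolding eq using assms
    by (intro sos_form_add sos_form_sum sos_form_scale sos_form_square poly_fun_add
        poly_fun_scale poly_fun_linear poly_fun_coord) auto
qed

text \<open>One term free of axioms and one with the axiom polynomial \<open>1 - ||v||^2\<close>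
  suffice. The latter polynomial costs degree 2, hence the bound \<open>(l - 2) div 2\<close> for
  \<open>g\<close>.\<close>

lemma sos_proof_from_form:
  assumes "sos_form d (l div 2) f" "sos_form d ((l - 2) div 2) g" "2 \<le> l"
    and r: "\<And>v. r v = f v + g v * (1 - (\<Sum>i<d. (v i)\<^sup>2))"
  shows "sos_proof d l r"
proof -
  obtain ps qs where ps: "\<forall>p\<in>set ps. poly_fun d (l div 2) p" "\<forall>v. f v = (\<Sum>p\<leftarrow>ps. (p v)\<^sup>2)"
    and qs: "\<forall>p\<in>set qs. poly_fun d ((l - 2) div 2) p" "\<forall>v. g v = (\<Sum>p\<leftarrow>qs. (p v)\<^sup>2)"
    using assms(1,2) unfolding sos_form_def by blast
  show ?thesis
    unfolding sos_proof_def using ps(1) qs(1) assms(3)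
    by (intro exI[of _ "[(ps, 0, 1), (qs, 1, -1)]"]) (auto simp: r ps(2) qs(2) numeral_2_eq_2 algebra_simps)
qed

section \<open>Harmonic analysis on the cube\<close>

text \<open>The cube \<open>{-1, 1}\<^sup>I\<close> is encoded as \<open>Pow I\<close>: a subset stands for the set of
  coordinates that are equal to -1.\<close>

definition sg :: "'i set \<Rightarrow> 'i \<Rightarrow> real" where
  "sg A i = (if i \<in> A then -1 else 1)"

definition cube_exp :: "'i set \<Rightarrow> ('i set \<Rightarrow> real) \<Rightarrow> real" where
  "cube_exp I f = (\<Sum>A\<in>Pow I. f A) / 2 ^ card I"

text \<open>The character of the cube indexed by \<open>B\<close>, evaluated at the point
  \<open>A\<close>.\<close>

definition walsh :: "'i set \<Rightarrow> 'i set \<Rightarrow> real" where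
  "walsh B A = (\<Prod>i\<in>B. sg A i)"

lemma sg_square [simp]: "(sg A i)\<^sup>2 = 1" "sg A i * sg A i = 1"
  by (auto simp: sg_def)

lemma abs_sg [simp]: "\<bar>sg A i\<bar> = 1"
  by (auto simp: sg_def)

lemma cube_exp_cong: "(\<And>A. A \<subseteq> I \<Longrightarrow> f A = g A) \<Longrightarrow> cube_exp I f = cube_exp I g"
  unfolding cube_exp_def by (intro arg_cong2[of _ _ _ _ "(/)"] sum.cong) auto

lemma cube_exp_add: "cube_exp I (\<lambda>A. f A + g A) = cube_exp I f + cube_exp I g"
  by (simp add: cube_exp_def sum.distrib add_divide_distrib)

lemma cube_exp_diff: "cube_exp I (\<lambda>A. f A - g A) = cube_exp I f - cube_exp I g"
  by (simp add: cube_exp_def sum_subtractf diff_divide_distrib)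

lemma cube_exp_scale: "cube_exp I (\<lambda>A. c * f A) = c * cube_exp I f"
  by (simp add: cube_exp_def sum_distrib_left)

lemma cube_exp_sum: "cube_exp I (\<lambda>A. \<Sum>k\<in>K. f k A) = (\<Sum>k\<in>K. cube_exp I (f k))"
  unfolding cube_exp_def sum_divide_distrib[symmetric] by (subst sum.swap) simp

lemma cube_exp_const: "finite I \<Longrightarrow> cube_exp I (\<lambda>A. c) = c"
  by (simp add: cube_exp_def card_Pow)

lemma cube_exp_mono: "(\<And>A. A \<subseteq> I \<Longrightarrow> f A \<le> g A) \<Longrightarrow> cube_exp I f \<le> cube_exp I g"
  unfolding cube_exp_def by (intro divide_right_mono sum_mono) auto

lemma cube_exp_nonneg: "(\<And>A. A \<subseteq> I \<Longrightarrow> 0 \<le> f A) \<Longrightarrow> 0 \<le> cube_exp I f"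
  unfolding cube_exp_def by (intro divide_nonneg_pos sum_nonneg) auto

lemma cube_exp_empty [simp]: "cube_exp {} f = f {}"
  by (simp add: cube_exp_def)

text \<open>Conditioning on the sign at \<open>x\<close>, which is 1 at \<open>A\<close> and -1 at
  \<open>insert x A\<close>. Inductions over the coordinates rest on this.\<close>

lemma cube_exp_insert:
  assumes "finite I" "x \<notin> I"
  shows "cube_exp (insert x I) f = cube_exp I (\<lambda>A. (f A + f (insert x A)) / 2)"
proof -
  have "(\<Sum>A\<in>Pow (insert x I). f A) = (\<Sum>A\<in>Pow I. f A) + (\<Sum>A\<in>insert x ` Pow I. f A)"
    unfolding Pow_insert using assms by (intro sum.union_disjoint) auto
  also have "(\<Sum>A\<in>insert x ` Pow I. f A) = (\<Sum>A\<in>Pow I. f (insert x A))"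
    using assms by (subst sum.reindex) (auto simp: inj_on_def)
  finally show ?thesis
    using assms by (simp add: cube_exp_def sum.distrib sum_divide_distrib[symmetric])
qed

text \<open>Complementation negates all signs at once and preserves the uniform
  distribution.\<close>

lemma cube_exp_flip:
  assumes "finite I"
  shows "cube_exp I (\<lambda>A. f (I - A)) = cube_exp I f"
proof -
  have "(\<Sum>A\<in>Pow I. f (I - A)) = (\<Sum>A\<in>Pow I. f A)"
    by (rule sum.reindex_bij_witness[of _ "\<lambda>A. I - A" "\<lambda>A. I - A"]) auto
  then show ?thesis by (simp add: cube_exp_def)
qed

text \<open>Independence of the signs: each new coordinate contributes the average of its factor
  over 1 and -1.\<close>

lemma cube_exp_prod:
  assumes "finite I"
  shows "cube_exp I (\<lambda>A. \<Prod>i\<in>I. \<phi> i (sg A i)) = (\<Prod>i\<in>I. (\<phi> i 1 + \<phi> i (-1)) / 2)"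
  using assms
proof (induction I rule: finite_induct)
  case (insert x I)
  have 1: "(\<Prod>i\<in>insert x I. \<phi> i (sg A i)) = \<phi> x 1 * (\<Prod>i\<in>I. \<phi> i (sg A i))" if "A \<subseteq> I" for A
    using insert that by (auto simp: sg_def)
  have 2: "(\<Prod>i\<in>insert x I. \<phi> i (sg (insert x A) i)) = \<phi> x (-1) * (\<Prod>i\<in>I. \<phi> i (sg A i))"
    if "A \<subseteq> I" for A
  proof -
    have "(\<Prod>i\<in>I. \<phi> i (sg (insert x A) i)) = (\<Prod>i\<in>I. \<phi> i (sg A i))"
      using insert(2) by (intro prod.cong) (auto simp: sg_def)
    moreover have "sg (insert x A) x = -1" by (simp add: sg_def)
    ultimately show ?thesis by (simp only: prod.insert[OF insert(1,2)])
  qed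
  have "cube_exp (insert x I) (\<lambda>A. \<Prod>i\<in>insert x I. \<phi> i (sg A i)) =
      cube_exp I (\<lambda>A. ((\<phi> x 1 + \<phi> x (-1)) / 2) * (\<Prod>i\<in>I. \<phi> i (sg A i)))"
    unfolding cube_exp_insert[OF insert(1,2)]
    by (intro cube_exp_cong) (simp only: 1 2, simp add: algebra_simps add_divide_distrib)
  then show ?case
    by (simp only: cube_exp_scale insert.IH prod.insert[OF insert(1,2)])
qed auto

text \<open>Orthonormality of the characters. In the product formula, an index in exactly one of
  \<open>B\<close> and \<open>C\<close> contributes the mean 0 of a sign; all other factors are
  1.\<close>

lemma cube_exp_walsh_mult:
  assumes "finite I" "B \<subseteq> I" "C \<subseteq> I"
  shows "cube_exp I (\<lambda>A. walsh B A * walsh C A) = (if B = C then 1 else 0)"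
proof -
  let ?\<phi> = "\<lambda>i x :: real. (if i \<in> B then x else 1) * (if i \<in> C then x else 1)"
  have "walsh D A = (\<Prod>i\<in>I. if i \<in> D then sg A i else 1)" if "D \<subseteq> I" for D A
    unfolding walsh_def using assms(1) that by (intro prod.mono_neutral_cong_left) auto
  then have "cube_exp I (\<lambda>A. walsh B A * walsh C A) = cube_exp I (\<lambda>A. \<Prod>i\<in>I. ?\<phi> i (sg A i))"
    using assms by (intro cube_exp_cong) (simp add: prod.distrib)
  also have "\<dots> = (\<Prod>i\<in>I. (?\<phi> i 1 + ?\<phi> i (-1)) / 2)"
    by (rule cube_exp_prod[OF assms(1)])
  also have "\<dots> = (if B = C then 1 else 0)"
  proof (cases "B = C")
    case True
    then show ?thesis by (auto intro!: prod.neutral)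
  next
    case False
    then obtain i where "i \<in> I" "(i \<in> B) \<noteq> (i \<in> C)" using assms by auto
    then have "(?\<phi> i 1 + ?\<phi> i (-1)) / 2 = 0" by auto
    with \<open>i \<in> I\<close> have "(\<Prod>i\<in>I. (?\<phi> i 1 + ?\<phi> i (-1)) / 2) = 0"
      using assms(1) by (intro prod_zero) blast+
    then show ?thesis using False by simp
  qed
  finally show ?thesis .
qed

lemma walsh_simps [simp]: "walsh {} A = 1" "walsh {i} A = sg A i"
  by (simp_all add: walsh_def)

text \<open>The algebra is left general because \<open>z\<close> is real for the outlier density and
  imaginary for the bounded products that correct the inliers.\<close>

lemma prod_one_plus_sg:
  fixes z :: "'a :: {real_algebra_1, comm_ring_1}"
  assumes "finite V"
  shows "(\<Prod>i\<in>V. 1 + z * of_real (sg A i)) = (\<Sum>B\<in>Pow V. z ^ card B * of_real (walsh B A))"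
proof -
  have "(\<Prod>i\<in>V. z * of_real (sg A i) + 1) =
      (\<Sum>B\<in>Pow V. (\<Prod>i\<in>B. z * of_real (sg A i)) * (\<Prod>i\<in>V - B. 1))"
    by (rule prod_add[OF assms])
  then show ?thesis by (simp add: prod.distrib walsh_def add.commute)
qed

text \<open>A function that depends only on the signs in \<open>V\<close> and is symmetric in them:
  the coefficient of a character depends on its level alone.\<close>

definition fourier :: "(nat \<Rightarrow> real) \<Rightarrow> 'i set \<Rightarrow> 'i set \<Rightarrow> real" where
  "fourier \<eta> V A = (\<Sum>B\<in>Pow V. \<eta> (card B) * walsh B A)"

text \<open>By orthonormality only characters that occur in both expansions survive, that is, those
  indexed by subsets of \<open>V \<inter> W\<close>.\<close>

lemma cube_exp_fourier_mult:
  assumes "finite I" "V \<subseteq> I" "W \<subseteq> I"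
  shows "cube_exp I (\<lambda>A. fourier \<eta> V A * fourier \<theta> W A) =
    (\<Sum>B\<in>Pow (V \<inter> W). \<eta> (card B) * \<theta> (card B))"
proof -
  have fin: "finite V" "finite W" using assms(1-3) by (auto intro: finite_subset)
  have "cube_exp I (\<lambda>A. fourier \<eta> V A * fourier \<theta> W A) =
     (\<Sum>B\<in>Pow V. \<Sum>C\<in>Pow W. \<eta> (card B) * \<theta> (card C) * cube_exp I (\<lambda>A. walsh B A * walsh C A))"
    unfolding fourier_def sum_product cube_exp_sum cube_exp_scale[symmetric]
    by (simp add: mult_ac)
  also have "\<dots> = (\<Sum>B\<in>Pow V. \<Sum>C\<in>Pow W. if B = C then \<eta> (card B) * \<theta> (card C) else 0)"
    using assms by (intro sum.cong) (auto simp: cube_exp_walsh_mult subset_iff)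
  also have "\<dots> = (\<Sum>B\<in>Pow V. if B \<in> Pow W then \<eta> (card B) * \<theta> (card B) else 0)"
    using fin by (intro sum.cong) (auto simp: sum.delta)
  also have "\<dots> = (\<Sum>B\<in>Pow V \<inter> Pow W. \<eta> (card B) * \<theta> (card B))"
    using fin by (simp add: sum.inter_restrict)
  finally show ?thesis by (simp add: Pow_Int_eq)
qed

lemma sum_Pow_card:
  fixes g :: "nat \<Rightarrow> real"
  assumes "finite V"
  shows "(\<Sum>B\<in>Pow V. g (card B)) = (\<Sum>j\<le>card V. real (card V choose j) * g j)"
proof -
  have "(\<Sum>B\<in>Pow V. g (card B)) = (\<Sum>j\<le>card V. \<Sum>B | B \<in> Pow V \<and> card B = j. g (card B))"
    using assms by (intro sum.group[symmetric]) (auto intro: card_mono)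
  also have "\<dots> = (\<Sum>j\<le>card V. real (card V choose j) * g j)"
    using assms by (intro sum.cong) (auto simp: n_subsets)
  finally show ?thesis .
qed

text \<open>Where defined, the quotient of the two binomials is a product of \<open>j\<close>
  fractions \<open>(m - i) / (n - i)\<close>, each at most \<open>m / n\<close> and at most 1. The
  first bound is spent on \<open>s\<close> of them, the second on the rest.\<close>

lemma binomial_power_le:
  assumes "m \<le> n" "s \<le> j"
  shows "(m choose j) * n ^ s \<le> m ^ s * (n choose j)"
  using assms(2)
proof (induction j arbitrary: s)
  case 0
  then show ?case by simp
next
  case (Suc j)
  have rec: "Suc j * (l choose Suc j) = (l - j) * (l choose j)" for l
    by (simp only: binomial_absorption binomial_absorb_comp)
  have "Suc j * ((m choose Suc j) * n ^ s) \<le> Suc j * (m ^ s * (n choose Suc j))"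
  proof (cases "s \<le> j")
    case True
    have "(m - j) * ((m choose j) * n ^ s) \<le> (n - j) * (m ^ s * (n choose j))"
      by (rule mult_mono) (use assms(1) Suc.IH[OF True] in auto)
    then have "((m - j) * (m choose j)) * n ^ s \<le> m ^ s * ((n - j) * (n choose j))"
      by (simp only: mult_ac)
    then show ?thesis unfolding rec[symmetric] by (simp only: mult_ac)
  next
    case False
    then have s: "s = Suc j" using Suc.prems by simp
    \<comment> \<open>The fraction bound \<open>(m - j) / (n - j) \<le> m / n\<close> without
      division; truncated subtraction covers \<open>m < j\<close>.\<close>
    have 1: "(m - j) * n \<le> m * (n - j)"
      using assms(1) by (cases "j \<le> m") (auto simp: diff_mult_distrib diff_mult_distrib2 mult_ac
          intro!: diff_le_mono2)
    have "((m - j) * n) * ((m choose j) * n ^ j) \<le> (m * (n - j)) * (m ^ j * (n choose j))"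
      by (rule mult_mono) (use 1 Suc.IH[of j] in auto)
    then have "((m - j) * (m choose j)) * n ^ Suc j \<le> m ^ Suc j * ((n - j) * (n choose j))"
      by (simp add: mult_ac)
    then show ?thesis unfolding s rec[symmetric] by (simp only: mult_ac)
  qed
  then show ?case by (simp only: mult_le_cancel1 zero_less_Suc simp_thms)
qed

text \<open>Passing from \<open>V\<close> to the overlap shrinks the mass of level \<open>j\<close>
  by a quotient of binomials, which is at most \<open>\<rho> ^ s\<close> on all levels from
  \<open>s\<close> on. This is the source of the gain in the exponent \<open>t + 1\<close>.\<close>

lemma cube_exp_fourier_correlation:
  assumes "finite I" "V \<subseteq> I" "W \<subseteq> I" "\<And>j. j < s \<Longrightarrow> \<eta> j = 0"
    and "real (card (V \<inter> W)) \<le> \<rho> * real (card V)"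
  shows "\<bar>cube_exp I (\<lambda>A. fourier \<eta> V A * fourier \<eta> W A)\<bar> \<le>
    \<rho> ^ s * cube_exp I (\<lambda>A. (fourier \<eta> V A)\<^sup>2)"
proof -
  let ?m = "card (V \<inter> W)" and ?n = "card V"
  have fin: "finite V" "finite W" using assms(1-3) by (auto intro: finite_subset)
  have mn: "?m \<le> ?n" using fin by (intro card_mono) auto
  have term_le: "real (?m choose j) * (\<eta> j)\<^sup>2 \<le> \<rho> ^ s * (real (?n choose j) * (\<eta> j)\<^sup>2)" for j
  proof (cases "j < s")
    case True
    then show ?thesis using assms(4) by simp
  next
    case False
    have "real (?m choose j) \<le> \<rho> ^ s * real (?n choose j)"
    proof (cases "?n = 0")
      case True
      then have "?m = 0" using mn by simp
      with True assms(4) show ?thesis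
      proof (cases "s = 0")
        case False
        then have "j \<noteq> 0" using \<open>\<not> j < s\<close> by auto
        then show ?thesis using True \<open>?m = 0\<close> by (cases j) auto
      qed simp
    next
      case n0: False
      have "real ((?m choose j) * ?n ^ s) \<le> real (?m ^ s * (?n choose j))"
        using binomial_power_le[OF mn, of s j] False by (intro of_nat_mono) simp
      also have "\<dots> = real ?m ^ s * real (?n choose j)" by simp
      also have "\<dots> \<le> (\<rho> * real ?n) ^ s * real (?n choose j)"
        using assms(5) by (intro mult_right_mono power_mono) auto
      finally show ?thesis using n0 by (simp add: power_mult_distrib mult_ac)
    qed
    then show ?thesis by (simp add: mult.assoc[symmetric] mult_right_mono)
  qed
  have "cube_exp I (\<lambda>A. fourier \<eta> V A * fourier \<eta> W A) = (\<Sum>j\<le>?m. real (?m choose j) * (\<eta> j)\<^sup>2)"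
    using assms(1-3) fin sum_Pow_card[of "V \<inter> W" "\<lambda>j. \<eta> j * \<eta> j"]
      sum_Pow_card[of V "\<lambda>j. \<eta> j * \<eta> j"]
    by (simp add: cube_exp_fourier_mult power2_eq_square del: Pow_Int_eq)
  then have "\<bar>cube_exp I (\<lambda>A. fourier \<eta> V A * fourier \<eta> W A)\<bar> = (\<Sum>j\<le>?m. real (?m choose j) * (\<eta> j)\<^sup>2)"
    by (simp only: abs_of_nonneg sum_nonneg mult_nonneg_nonneg of_nat_0_le_iff zero_le_power2)
  also have "\<dots> = (\<Sum>j\<le>?n. real (?m choose j) * (\<eta> j)\<^sup>2)"
    using mn by (intro sum.mono_neutral_left) (auto simp: binomial_eq_0)
  also have "\<dots> \<le> \<rho> ^ s * (\<Sum>j\<le>?n. real (?n choose j) * (\<eta> j)\<^sup>2)"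
    unfolding sum_distrib_left by (intro sum_mono term_le)
  also have "\<dots> = \<rho> ^ s * cube_exp I (\<lambda>A. (fourier \<eta> V A)\<^sup>2)"
    using assms(1-3) fin sum_Pow_card[of "V \<inter> W" "\<lambda>j. \<eta> j * \<eta> j"]
      sum_Pow_card[of V "\<lambda>j. \<eta> j * \<eta> j"]
    by (simp add: cube_exp_fourier_mult power2_eq_square del: Pow_Int_eq)
  finally show ?thesis .
qed

text \<open>The mean of \<open>(g - a * f)^2\<close> is expanded with \<open>a\<close> the
  correlation of \<open>f\<close> and \<open>g\<close>, using that the square of \<open>f\<close> is
  at most 1.\<close>

lemma cube_exp_cauchy_schwarz_bounded:
  assumes "finite I" "\<And>A. A \<subseteq> I \<Longrightarrow> \<bar>f A\<bar> \<le> 1"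
  shows "(cube_exp I (\<lambda>A. f A * g A))\<^sup>2 \<le> cube_exp I (\<lambda>A. (g A)\<^sup>2)"
proof -
  let ?a = "cube_exp I (\<lambda>A. f A * g A)"
  have "0 \<le> cube_exp I (\<lambda>A. (g A - ?a * f A)\<^sup>2)"
    by (intro cube_exp_nonneg) auto
  also have "\<dots> \<le> cube_exp I (\<lambda>A. ((g A)\<^sup>2 + ?a\<^sup>2) - (2 * ?a) * (f A * g A))"
  proof (intro cube_exp_mono)
    fix A assume "A \<subseteq> I"
    then have "(f A)\<^sup>2 \<le> 1" using assms(2)[of A] by (simp add: abs_square_le_1)
    then have "?a\<^sup>2 * (f A)\<^sup>2 \<le> ?a\<^sup>2 * 1" by (intro mult_left_mono) auto
    then show "(g A - ?a * f A)\<^sup>2 \<le> ((g A)\<^sup>2 + ?a\<^sup>2) - (2 * ?a) * (f A * g A)"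
      by (simp add: power2_diff power_mult_distrib algebra_simps)
  qed
  also have "\<dots> = cube_exp I (\<lambda>A. (g A)\<^sup>2) + ?a\<^sup>2 - 2 * ?a * ?a"
    by (simp only: cube_exp_diff cube_exp_add cube_exp_scale cube_exp_const[OF assms(1)])
  finally show ?thesis by (simp add: power2_eq_square)
qed

text \<open>\<open>f\<close> is tested against the sum of the \<open>h S\<close>, signed by the correlations.\<close>
lemma card_correlated_le:
  assumes "finite I" "finite F" "\<And>A. A \<subseteq> I \<Longrightarrow> \<bar>f A\<bar> \<le> 1"
    and diag: "\<And>S. S \<in> F \<Longrightarrow> cube_exp I (\<lambda>A. (h S A)\<^sup>2) \<le> X"
    and off: "\<And>S T. S \<in> F \<Longrightarrow> T \<in> F \<Longrightarrow> S \<noteq> T \<Longrightarrow>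
      \<bar>cube_exp I (\<lambda>A. h S A * h T A)\<bar> \<le> Y" "0 \<le> X" "0 \<le> Y"
    and "0 \<le> \<tau>" "\<And>S. S \<in> F \<Longrightarrow> \<tau> \<le> \<bar>cube_exp I (\<lambda>A. f A * h S A)\<bar>"
  shows "real (card F) * \<tau>\<^sup>2 \<le> X + real (card F) * Y"
proof -
  let ?N = "real (card F)"
  define e where "e S = sgn (cube_exp I (\<lambda>A. f A * h S A))" for S
  define g where "g A = (\<Sum>S\<in>F. e S * h S A)" for A
  have e: "\<bar>e S\<bar> \<le> 1" for S by (auto simp: e_def sgn_if)
  have "?N * \<tau> \<le> (\<Sum>S\<in>F. \<bar>cube_exp I (\<lambda>A. f A * h S A)\<bar>)"
    using assms(9) sum_mono[of F "\<lambda>_. \<tau>"] by simp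
  also have "\<dots> = (\<Sum>S\<in>F. e S * cube_exp I (\<lambda>A. f A * h S A))"
    by (intro sum.cong) (auto simp: e_def abs_sgn mult.commute)
  also have "\<dots> = cube_exp I (\<lambda>A. f A * g A)"
    by (simp add: g_def cube_exp_scale[symmetric] sum_distrib_left mult_ac cube_exp_sum)
  finally have "(?N * \<tau>)\<^sup>2 \<le> (cube_exp I (\<lambda>A. f A * g A))\<^sup>2"
    using \<open>0 \<le> \<tau>\<close> by (intro power_mono) auto
  also have "\<dots> \<le> cube_exp I (\<lambda>A. (g A)\<^sup>2)"
    using assms(1,3) by (rule cube_exp_cauchy_schwarz_bounded)
  also have "\<dots> = (\<Sum>S\<in>F. \<Sum>T\<in>F. (e S * e T) * cube_exp I (\<lambda>A. h S A * h T A))"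
    by (simp add: g_def power2_eq_square sum_product cube_exp_scale[symmetric] mult_ac cube_exp_sum)
  \<comment> \<open>Signs of modulus at most 1 drop out: diagonal pairs cost at most
    \<open>X\<close> and all others at most \<open>Y\<close>.\<close>
  also have "\<dots> \<le> (\<Sum>S\<in>F. \<Sum>T\<in>F. (if S = T then X else 0) + Y)"
  proof (intro sum_mono)
    fix S T assume ST: "S \<in> F" "T \<in> F"
    have "\<bar>e S * e T\<bar> \<le> 1" using e[of S] e[of T] by (simp add: abs_mult mult_le_one)
    then have "\<bar>(e S * e T) * cube_exp I (\<lambda>A. h S A * h T A)\<bar> \<le> \<bar>cube_exp I (\<lambda>A. h S A * h T A)\<bar>"
      unfolding abs_mult[of "e S * e T"] by (intro mult_left_le_one_le) auto
    then have "(e S * e T) * cube_exp I (\<lambda>A. h S A * h T A) \<le> \<bar>cube_exp I (\<lambda>A. h S A * h T A)\<bar>"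
      by linarith
    also have "\<dots> \<le> (if S = T then X else 0) + Y"
    proof (cases "S = T")
      case True
      have "0 \<le> cube_exp I (\<lambda>A. (h S A)\<^sup>2)" by (intro cube_exp_nonneg) auto
      then show ?thesis using diag[OF ST(1)] off(3) True by (simp add: power2_eq_square)
    next
      case False
      then show ?thesis using off(1)[OF ST] by simp
    qed
    finally show "(e S * e T) * cube_exp I (\<lambda>A. h S A * h T A) \<le> (if S = T then X else 0) + Y" .
  qed
  also have "\<dots> = ?N * X + ?N * ?N * Y"
    using assms(2) by (simp add: sum.distrib distrib_left)
  finally have "?N * (?N * \<tau>\<^sup>2) \<le> ?N * (X + ?N * Y)"
    by (simp add: power2_eq_square algebra_simps)
  then show ?thesis
    using \<open>0 \<le> X\<close> by (cases "card F = 0") (auto simp: mult_le_cancel_left_pos)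
qed

section \<open>Even moments of sums of signs, bounded up to sums of squares\<close>

lemma poly_fun_cube_exp:
  assumes "\<And>A. A \<subseteq> I \<Longrightarrow> poly_fun d n (p A)"
  shows "poly_fun d n (\<lambda>v. cube_exp I (\<lambda>A. c A * p A v))"
  unfolding cube_exp_def sum_divide_distrib times_divide_eq_left[symmetric]
  using assms by (intro poly_fun_sum poly_fun_scale) auto

lemma sos_form_cube_exp:
  assumes "\<And>A. A \<subseteq> I \<Longrightarrow> 0 \<le> c A" "\<And>A. A \<subseteq> I \<Longrightarrow> poly_fun d n (p A)"
  shows "sos_form d n (\<lambda>v. cube_exp I (\<lambda>A. c A * (p A v)\<^sup>2))"
  unfolding cube_exp_def sum_divide_distrib times_divide_eq_left[symmetric]
  using assms by (intro sos_form_sum sos_form_scale sos_form_square) auto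

text \<open>The sum below is the moment of order \<open>2m\<close> of \<open>X + a s\<close>, where \<open>s\<close> is a random sign that
  is independent of \<open>X\<close>, and \<open>M j\<close> is the moment of order \<open>2j\<close> of \<open>X\<close>.\<close>
lemma sos_even_moment_step:
  assumes M: "\<And>m. sos_form d m (\<lambda>v. fact (2 * m) / fact m * s v ^ m - M m v)"
    and "sos_form d 1 s" "poly_fun d 1 a"
  shows "sos_form d m (\<lambda>v. fact (2 * m) / fact m * (s v + (a v)\<^sup>2) ^ m -
      (\<Sum>j\<le>m. real (2 * m choose (2 * j)) * M (m - j) v * a v ^ (2 * j)))"
proof -
  let ?c = "\<lambda>m. fact (2 * m) / fact m :: real"
  \<comment> \<open>\<open>(2 m)! / m!\<close> is \<open>2 ^ m\<close> times the Gaussian moment.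
    Comparing the two binomial expansions term by term comes down to
    \<open>j! \<le> (2 j)!\<close>.\<close>
  have coef: "real (2 * m choose (2 * j)) * ?c (m - j) \<le> ?c m * real (m choose j)" if "j \<le> m" for j
  proof -
    have "real (2 * m choose (2 * j)) * ?c (m - j) = fact (2 * m) / (fact (2 * j) * fact (m - j))"
      using that by (simp add: binomial_fact diff_mult_distrib2[symmetric])
    also have "\<dots> \<le> fact (2 * m) / (fact j * fact (m - j))"
      by (intro divide_left_mono mult_right_mono fact_mono mult_pos_pos) auto
    also have "\<dots> = ?c m * real (m choose j)"
      using that by (simp add: binomial_fact)
    finally show ?thesis .
  qed
  \<comment> \<open>Each term is a square times the sum of two forms: the surplus of the
    coefficient, and the assumption for \<open>m - j\<close>.\<close>
  have eq: "?c m * (s v + (a v)\<^sup>2) ^ m -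
      (\<Sum>j\<le>m. real (2 * m choose (2 * j)) * M (m - j) v * a v ^ (2 * j)) =
      (\<Sum>j\<le>m. (a v ^ j)\<^sup>2 *
        ((?c m * real (m choose j) - real (2 * m choose (2 * j)) * ?c (m - j)) * s v ^ (m - j) +
          real (2 * m choose (2 * j)) * (?c (m - j) * s v ^ (m - j) - M (m - j) v)))" for v
    unfolding add.commute[of "s v"] binomial_ring sum_distrib_left sum_subtractf[symmetric]
    by (intro sum.cong) (auto simp: algebra_simps power_mult[symmetric])
  have "sos_form d (j + (m - j)) (\<lambda>v. (a v ^ j)\<^sup>2 *
        ((?c m * real (m choose j) - real (2 * m choose (2 * j)) * ?c (m - j)) * s v ^ (m - j) +
          real (2 * m choose (2 * j)) * (?c (m - j) * s v ^ (m - j) - M (m - j) v)))"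
    if "j \<le> m" for j
    using that coef[OF that] sos_form_power[OF assms(2), of "m - j"] poly_fun_power[OF assms(3), of j]
    by (intro sos_form_mult sos_form_square sos_form_add sos_form_scale M) auto
  then show ?thesis
    unfolding eq by (intro sos_form_sum) simp
qed

lemma even_power_average:
  fixes x a :: real
  shows "((x + a) ^ (2 * m) + (x - a) ^ (2 * m)) / 2 =
    (\<Sum>j\<le>m. real (2 * m choose (2 * j)) * x ^ (2 * (m - j)) * a ^ (2 * j))"
proof -
  \<comment> \<open>The even exponent allows the swap, so that both expansions run in powers of
    \<open>a\<close> and the odd ones cancel.\<close>
  have "(x - a) ^ (2 * m) = (a - x) ^ (2 * m)"
    by (simp add: power_mult power2_commute)
  also have "\<dots> = (\<Sum>k\<le>2 * m. real (2 * m choose k) * a ^ k * (- x) ^ (2 * m - k))"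
    using binomial_ring[of a "- x" "2 * m"] by simp
  finally have "((x + a) ^ (2 * m) + (x - a) ^ (2 * m)) / 2 =
      (\<Sum>k\<le>2 * m. (real (2 * m choose k) * a ^ k * x ^ (2 * m - k) +
        real (2 * m choose k) * a ^ k * (- x) ^ (2 * m - k)) / 2)"
    by (simp add: add.commute[of x] binomial_ring[of a x] sum.distrib sum_divide_distrib[symmetric]
        add_divide_distrib)
  also have "\<dots> = (\<Sum>k\<in>(*) 2 ` {..m}. real (2 * m choose k) * a ^ k * x ^ (2 * m - k))"
  proof (rule sum.mono_neutral_cong_right)
    show "\<forall>k\<in>{..2 * m} - (*) 2 ` {..m}. (real (2 * m choose k) * a ^ k * x ^ (2 * m - k) +
        real (2 * m choose k) * a ^ k * (- x) ^ (2 * m - k)) / 2 = 0"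
    proof
      fix k assume k: "k \<in> {..2 * m} - (*) 2 ` {..m}"
      have "odd k"
      proof
        assume "even k"
        then obtain j where "k = 2 * j" by (rule evenE)
        with k show False by auto
      qed
      then have "odd (2 * m - k)" using k by simp
      then show "(real (2 * m choose k) * a ^ k * x ^ (2 * m - k) +
        real (2 * m choose k) * a ^ k * (- x) ^ (2 * m - k)) / 2 = 0"
        by simp
    qed
    fix k assume "k \<in> (*) 2 ` {..m}"
    then have "even (2 * m - k)" by auto
    then show "(real (2 * m choose k) * a ^ k * x ^ (2 * m - k) +
        real (2 * m choose k) * a ^ k * (- x) ^ (2 * m - k)) / 2 =
        real (2 * m choose k) * a ^ k * x ^ (2 * m - k)"
      by simp
  qed auto
  also have "\<dots> = (\<Sum>j\<le>m. real (2 * m choose (2 * j)) * x ^ (2 * (m - j)) * a ^ (2 * j))"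
    by (subst sum.reindex) (auto simp: inj_on_def diff_mult_distrib2 intro!: sum.cong)
  finally show ?thesis .
qed

text \<open>Khintchine's inequality for even moments, in sum of squares form. Signs are added one at
  a time, averaging over the new one.\<close>

lemma sos_cube_even_moment:
  assumes "finite I" "\<And>i. i \<in> I \<Longrightarrow> poly_fun d 1 (a i)"
  shows "sos_form d m (\<lambda>v. fact (2 * m) / fact m * (\<Sum>i\<in>I. (a i v)\<^sup>2) ^ m -
      cube_exp I (\<lambda>A. (\<Sum>i\<in>I. sg A i * a i v) ^ (2 * m)))"
  using assms
proof (induction I arbitrary: m rule: finite_induct)
  case empty
  show ?case by (cases m) (auto intro!: sos_form_const)
next
  case (insert x I)
  let ?L = "\<lambda>A v. \<Sum>i\<in>I. sg A i * a i v"
  have 1: "(\<Sum>i\<in>insert x I. sg A i * a i v) = ?L A v + a x v"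
    and 2: "(\<Sum>i\<in>insert x I. sg (insert x A) i * a i v) = ?L A v - a x v" if "A \<subseteq> I" for A v
    using insert that by (auto simp: sg_def intro!: sum.cong)
  have eq: "cube_exp (insert x I) (\<lambda>A. (\<Sum>i\<in>insert x I. sg A i * a i v) ^ (2 * m)) =
      (\<Sum>j\<le>m. real (2 * m choose (2 * j)) * cube_exp I (\<lambda>A. ?L A v ^ (2 * (m - j))) * a x v ^ (2 * j))"
    for v
  proof -
    have "cube_exp (insert x I) (\<lambda>A. (\<Sum>i\<in>insert x I. sg A i * a i v) ^ (2 * m)) =
      cube_exp I (\<lambda>A. ((?L A v + a x v) ^ (2 * m) + (?L A v - a x v) ^ (2 * m)) / 2)"
      unfolding cube_exp_insert[OF insert(1,2)] by (intro cube_exp_cong) (simp only: 1 2)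
    also have "\<dots> = cube_exp I (\<lambda>A. \<Sum>j\<le>m. (real (2 * m choose (2 * j)) * a x v ^ (2 * j)) *
        ?L A v ^ (2 * (m - j)))"
      unfolding even_power_average by (simp only: mult_ac)
    finally show ?thesis unfolding cube_exp_sum cube_exp_scale by (simp add: mult_ac)
  qed
  have s: "(\<Sum>i\<in>insert x I. (a i v)\<^sup>2) = (\<Sum>i\<in>I. (a i v)\<^sup>2) + (a x v)\<^sup>2" for v
    using insert by simp
  show ?case
    unfolding eq s
  proof (rule sos_even_moment_step)
    show "sos_form d 1 (\<lambda>v. \<Sum>i\<in>I. (a i v)\<^sup>2)"
      using insert.prems by (intro sos_form_sum sos_form_square) auto
  qed (use insert in auto)
qed

text \<open>The sum of signs is symmetric, so the shift \<open>b\<close> may be given a random sign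
  as well and behaves like one more summand.\<close>

lemma sos_cube_shifted_even_moment:
  assumes I: "finite I" and a: "\<And>i. i \<in> I \<Longrightarrow> poly_fun d 1 (a i)" and b: "poly_fun d 1 b"
  shows "sos_form d m (\<lambda>v. fact (2 * m) / fact m * ((\<Sum>i\<in>I. (a i v)\<^sup>2) + (b v)\<^sup>2) ^ m -
      cube_exp I (\<lambda>A. ((\<Sum>i\<in>I. sg A i * a i v) - b v) ^ (2 * m)))"
proof -
  let ?L = "\<lambda>A v. \<Sum>i\<in>I. sg A i * a i v"
  have eq: "cube_exp I (\<lambda>A. (?L A v - b v) ^ (2 * m)) =
      (\<Sum>j\<le>m. real (2 * m choose (2 * j)) * cube_exp I (\<lambda>A. ?L A v ^ (2 * (m - j))) * b v ^ (2 * j))"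
    for v
  proof -
    have flip: "?L (I - A) v = - ?L A v" if "A \<subseteq> I" for A
      using that by (auto simp: sg_def sum_negf[symmetric] intro!: sum.cong)
    have "cube_exp I (\<lambda>A. (?L A v - b v) ^ (2 * m)) = cube_exp I (\<lambda>A. (?L (I - A) v - b v) ^ (2 * m))"
      using cube_exp_flip[OF I, of "\<lambda>A. (?L A v - b v) ^ (2 * m)"] by simp
    also have "\<dots> = cube_exp I (\<lambda>A. (?L A v + b v) ^ (2 * m))"
    proof (rule cube_exp_cong)
      fix A assume "A \<subseteq> I"
      then have "(?L (I - A) v - b v)\<^sup>2 = (?L A v + b v)\<^sup>2"
        by (simp only: flip) (simp add: power2_eq_square algebra_simps)
      then show "(?L (I - A) v - b v) ^ (2 * m) = (?L A v + b v) ^ (2 * m)"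
        by (simp only: power_mult)
    qed
    finally have avg: "cube_exp I (\<lambda>A. (?L A v - b v) ^ (2 * m)) =
        cube_exp I (\<lambda>A. (?L A v + b v) ^ (2 * m))" .
    have "cube_exp I (\<lambda>A. (?L A v - b v) ^ (2 * m)) =
        cube_exp I (\<lambda>A. (1 / 2) * ((?L A v + b v) ^ (2 * m) + (?L A v - b v) ^ (2 * m)))"
      unfolding cube_exp_scale cube_exp_add avg by simp
    also have "\<dots> = cube_exp I (\<lambda>A. \<Sum>j\<le>m. (real (2 * m choose (2 * j)) * b v ^ (2 * j)) *
        ?L A v ^ (2 * (m - j)))"
      using even_power_average[of _ "b v" m] by (intro cube_exp_cong) (simp add: mult_ac)
    finally show ?thesis unfolding cube_exp_sum cube_exp_scale by (simp add: mult_ac)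
  qed
  show ?thesis
    unfolding eq
  proof (rule sos_even_moment_step)
    show "sos_form d 1 (\<lambda>v. \<Sum>i\<in>I. (a i v)\<^sup>2)"
      using a by (intro sos_form_sum sos_form_square)
  qed (rule sos_cube_even_moment[OF I a] b | assumption)+
qed

section \<open>Moment matching\<close>

text \<open>The weights are the Lagrange basis polynomials at \<open>y\<close>; interpolation at
  \<open>t + 1\<close> distinct nodes reproduces each power up to \<open>t\<close>.\<close>

lemma lagrange_weights:
  fixes x :: "nat \<Rightarrow> 'a :: field_char_0"
  assumes inj: "inj_on x {..t}" and "j \<le> t"
  shows "(\<Sum>l\<le>t. (\<Prod>m\<in>{..t} - {l}. (y - x m) / (x l - x m)) * x l ^ j) = y ^ j"
proof -
  define L where "L l = (\<Prod>m\<in>{..t} - {l}. smult (1 / (x l - x m)) [:- x m, 1:])" for l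
  have poly_L: "poly (L l) u = (\<Prod>m\<in>{..t} - {l}. (u - x m) / (x l - x m))" for l u
    by (simp add: L_def poly_prod diff_divide_distrib)
  define q where "q = (\<Sum>l\<le>t. smult (x l ^ j) (L l))"
  have "degree (L l) \<le> t" if "l \<le> t" for l
  proof -
    have "degree (L l) \<le> (\<Sum>m\<in>{..t} - {l}. degree (smult (1 / (x l - x m)) [:- x m, 1:]))"
      using degree_prod_sum_le[of "{..t} - {l}" "\<lambda>m. smult (1 / (x l - x m)) [:- x m, 1:]"]
      by (simp add: L_def o_def)
    also have "\<dots> \<le> (\<Sum>m\<in>{..t} - {l}. 1)"
      by (intro sum_mono) (auto intro: order_trans[OF degree_smult_le])
    also have "\<dots> = t" using that by simp
    finally show ?thesis .
  qed
  then have "degree q \<le> t"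
    unfolding q_def by (intro degree_sum_le) (auto intro: order_trans[OF degree_smult_le])
  moreover have "poly q u = poly (monom 1 j) u" if u: "u \<in> x ` {..t}" for u
  proof -
    obtain k where k: "k \<le> t" "u = x k" using u by auto
    have "poly (L l) u = (if l = k then 1 else 0)" if "l \<le> t" for l
    proof (cases "l = k")
      case True
      have "(x k - x m) / (x k - x m) = 1" if "m \<in> {..t} - {k}" for m
        using inj_onD[OF inj, of k m] k that by auto
      then show ?thesis using True by (simp add: poly_L k)
    next
      case False
      then have "(\<Prod>m\<in>{..t} - {l}. (u - x m) / (x l - x m)) = 0"
        using k by (intro prod_zero) (auto intro!: bexI[of _ k])
      then show ?thesis using False by (simp add: poly_L)
    qed
    then have "(\<Sum>l\<le>t. x l ^ j * poly (L l) u) = (\<Sum>l\<le>t. if l = k then x l ^ j else 0)"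
      by (intro sum.cong) auto
    then have "poly q u = (\<Sum>l\<le>t. if l = k then x l ^ j else 0)"
      by (simp add: q_def poly_sum)
    also have "\<dots> = x k ^ j" using k by simp
    finally show ?thesis using k by (simp add: poly_monom)
  qed
  moreover have "card (x ` {..t}) > t" using card_image[OF inj] by simp
  moreover have "degree (monom (1 :: 'a) j) \<le> t"
    using \<open>j \<le> t\<close> by (simp add: degree_monom_eq)
  ultimately have "q = monom 1 j"
    by (intro poly_eqI_degree[of "x ` {..t}"]) auto
  then have "poly q y = y ^ j" by (simp add: poly_monom)
  then show ?thesis by (simp add: q_def poly_sum poly_L mult.commute)
qed

text \<open>The nodes are imaginary because products of the factors \<open>1 + \<i> \<theta> s\<close> over signs \<open>s\<close> are
  bounded, in contrast to those of \<open>1 + \<theta> s\<close>.\<close>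
lemma imaginary_nodes_weights:
  fixes z :: real
  assumes "t \<ge> 1" "z \<ge> 0"
  obtains w :: "nat \<Rightarrow> complex" where
    "\<And>j. j \<le> t \<Longrightarrow> (\<Sum>l\<le>t. w l * (\<i> * of_real (real l / real t)) ^ j) = of_real z ^ j"
    "\<And>l. l \<le> t \<Longrightarrow> norm (w l) \<le> ((z + 1) * real t) ^ t"
proof -
  define x where "x l = \<i> * of_real (real l / real t)" for l
  define w where "w l = (\<Prod>m\<in>{..t} - {l}. (of_real z - x m) / (x l - x m))" for l
  have x_diff: "x l - x m = \<i> * of_real ((real l - real m) / real t)" for l m
    by (simp add: x_def right_diff_distrib diff_divide_distrib)
  \<comment> \<open>Neighbouring nodes are \<open>1 / t\<close> apart and all nodes lie in the unit
    disc, so each of the \<open>t\<close> factors of a weight is at most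
    \<open>(z + 1) * t\<close>.\<close>
  have norm_x_diff: "1 / real t \<le> norm (x l - x m)" if "l \<noteq> m" for l m
  proof -
    have "1 \<le> \<bar>real l - real m\<bar>" using that by linarith
    then show ?thesis
      using assms(1) unfolding x_diff norm_mult norm_of_real
      by (simp add: divide_right_mono del: of_real_divide)
  qed
  have "inj_on x {..t}"
    using norm_x_diff assms(1) by (force simp: inj_on_def)
  then have "(\<Sum>l\<le>t. w l * x l ^ j) = of_real z ^ j" if "j \<le> t" for j
    unfolding w_def using that by (rule lagrange_weights)
  moreover have "norm (w l) \<le> ((z + 1) * real t) ^ t" if "l \<le> t" for l
  proof -
    have "norm (w l) = (\<Prod>m\<in>{..t} - {l}. norm (of_real z - x m) / norm (x l - x m))"
      by (simp add: w_def prod_norm[symmetric] norm_divide)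
    also have "\<dots> \<le> (\<Prod>m\<in>{..t} - {l}. (z + 1) * real t)"
    proof (intro prod_mono conjI)
      fix m assume m: "m \<in> {..t} - {l}"
      have "norm (of_real z - x m) \<le> norm (of_real z :: complex) + norm (x m)"
        by (rule norm_triangle_ineq4)
      also have "\<dots> \<le> z + 1"
        using m assms unfolding x_def norm_mult norm_of_real
        by (simp add: divide_le_eq del: of_real_divide)
      finally have num: "norm (of_real z - x m) \<le> z + 1" .
      have "norm (of_real z - x m) / norm (x l - x m) \<le> (z + 1) / (1 / real t)"
        using num norm_x_diff[of l m] m assms by (intro frac_le) auto
      then show "norm (of_real z - x m) / norm (x l - x m) \<le> (z + 1) * real t" by simp
    qed simp
    also have "\<dots> = ((z + 1) * real t) ^ t" using that by simp
    finally show ?thesis .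
  qed
  ultimately show ?thesis
    using that[of w] unfolding x_def by blast
qed

lemma one_plus_power_le_exp:
  fixes x :: real
  assumes "0 \<le> x"
  shows "(1 + x) ^ n \<le> exp (real n * x)"
  unfolding exp_of_nat_mult by (rule power_mono) (use assms in \<open>auto simp: exp_ge_add_one_self\<close>)

text \<open>Whatever the sign, a factor has squared norm \<open>1 + a^2\<close>, so the squared
  product is at most \<open>(1 + 1 / n) ^ n\<close>, hence at most 4.\<close>

lemma norm_prod_imaginary_le:
  fixes a :: real
  assumes "finite V" "card V = n" "a\<^sup>2 \<le> 1 / real n"
  shows "norm (\<Prod>i\<in>V. 1 + \<i> * of_real a * of_real (sg A i)) \<le> 2"
proof -
  have norm1: "(norm (1 + \<i> * of_real a * of_real (sg A i)))\<^sup>2 = 1 + a\<^sup>2" for i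
    by (simp add: cmod_power2 power_mult_distrib)
  have "(norm (\<Prod>i\<in>V. 1 + \<i> * of_real a * of_real (sg A i)))\<^sup>2 = (1 + a\<^sup>2) ^ n"
    using assms(1,2) by (simp add: prod_norm[symmetric] prod_power_distrib norm1)
  also have "\<dots> \<le> exp (real n * a\<^sup>2)"
    by (rule one_plus_power_le_exp) simp
  also have "\<dots> \<le> exp 1"
    using assms(3) by (cases "n = 0") (auto simp: field_simps)
  also have "\<dots> \<le> 2\<^sup>2" using exp_le by simp
  finally show ?thesis by (rule power2_le_imp_le) simp
qed

text \<open>The binomial theorem, read off from the product expansion at the point
  \<open>{}\<close>, where all signs are 1.\<close>

lemma sum_Pow_power_card:
  fixes c :: real
  assumes "finite V"
  shows "(\<Sum>B\<in>Pow V. c ^ card B) = (1 + c) ^ card V"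
  using prod_one_plus_sg[OF assms, of c "{}"] by (simp add: walsh_def sg_def)

text \<open>The Fourier coefficients \<open>\<beta>\<close> of the outliers (a product of biased signs) and \<open>\<rho>\<close> of the
  correction of the inlier density.\<close>
lemma moment_matching_coefficients:
  fixes z eps :: real
  assumes "t \<ge> 1" "z \<ge> 0" "eps > 0" "n \<ge> 1" "z\<^sup>2 \<le> real n"
    and small: "eps * (real t + 1) * ((z + 1) * real t) ^ t \<le> 1 / 4"
  obtains \<rho> \<beta> :: "nat \<Rightarrow> real" where
    "\<rho> 0 = - eps" "\<rho> 1 = - eps * z / sqrt (real n)" "\<beta> 0 = 1"
    "\<And>j. j \<le> t \<Longrightarrow> \<rho> j + eps * \<beta> j = 0"
    "\<And>V A :: 'i set. finite V \<Longrightarrow> card V = n \<Longrightarrow> \<bar>fourier \<rho> V A\<bar> \<le> 1 / 2"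
    "\<And>V A :: 'i set. finite V \<Longrightarrow> card V = n \<Longrightarrow> 0 \<le> fourier \<beta> V A"
    "\<And>I V :: 'i set. finite I \<Longrightarrow> V \<subseteq> I \<Longrightarrow> card V = n \<Longrightarrow>
      cube_exp I (\<lambda>A. (fourier \<beta> V A)\<^sup>2) \<le> exp (z\<^sup>2)"
proof -
  obtain w where w: "\<And>j. j \<le> t \<Longrightarrow> (\<Sum>l\<le>t. w l * (\<i> * of_real (real l / real t)) ^ j) = of_real z ^ j"
    and norm_w: "\<And>l. l \<le> t \<Longrightarrow> norm (w l) \<le> ((z + 1) * real t) ^ t"
    using imaginary_nodes_weights[OF assms(1,2)] by blast
  \<comment> \<open>The interpolation nodes, scaled so that products over \<open>n\<close> signs
    stay bounded.\<close>
  define a where "a l = real l / real t / sqrt (real n)" for l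
  define \<beta> where "\<beta> j = (z / sqrt (real n)) ^ j" for j
  \<comment> \<open>Level coefficients of \<open>- eps\<close> times the real part of the weighted
    combination of imaginary products.\<close>
  define \<rho> where "\<rho> j = - eps * Re (\<Sum>l\<le>t. w l * (\<i> * of_real (a l)) ^ j)" for j
  have \<rho>: "\<rho> j = - eps * \<beta> j" if "j \<le> t" for j
  proof -
    have "(\<Sum>l\<le>t. w l * (\<i> * of_real (a l)) ^ j) =
        (\<Sum>l\<le>t. w l * (\<i> * of_real (real l / real t)) ^ j) / of_real (sqrt (real n)) ^ j"
      by (simp add: a_def sum_divide_distrib power_divide power_mult_distrib)
    also have "\<dots> = of_real (\<beta> j)"
      unfolding w[OF that] \<beta>_def by (simp add: power_divide)
    finally show ?thesis by (simp add: \<rho>_def)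
  qed
  have fourier_\<beta>: "fourier \<beta> V A = (\<Prod>i\<in>V. 1 + z / sqrt (real n) * sg A i)" if "finite V" for V A :: "'i set"
    using prod_one_plus_sg[OF that, of "z / sqrt (real n)" A] by (simp add: fourier_def \<beta>_def)
  have fourier_\<rho>: "fourier \<rho> V A =
      - eps * Re (\<Sum>l\<le>t. w l * (\<Prod>i\<in>V. 1 + \<i> * of_real (a l) * of_real (sg A i)))"
    if "finite V" for V A :: "'i set"
  proof -
    have "fourier \<rho> V A = - eps * Re (\<Sum>B\<in>Pow V. \<Sum>l\<le>t. w l * (\<i> * of_real (a l)) ^ card B * of_real (walsh B A))"
    proof -
      have Re_mult: "Re c * r = Re (c * of_real r)" for c :: complex and r :: real by simp
      show ?thesis
        unfolding fourier_def \<rho>_def mult.assoc[of "- eps"] Re_mult sum_distrib_right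
        by (simp only: sum_distrib_left[symmetric] Re_sum[symmetric])
    qed
    also have "\<dots> = - eps * Re (\<Sum>l\<le>t. w l * (\<Prod>i\<in>V. 1 + \<i> * of_real (a l) * of_real (sg A i)))"
      unfolding prod_one_plus_sg[OF that] sum_distrib_left by (subst sum.swap) (simp add: mult_ac)
    finally show ?thesis .
  qed
  show ?thesis
  proof (rule that)
    show "\<rho> 0 = - eps" "\<rho> 1 = - eps * z / sqrt (real n)" "\<beta> 0 = 1"
      using \<rho>[of 0] \<rho>[of 1] assms(1) by (simp_all add: \<beta>_def)
    show "\<rho> j + eps * \<beta> j = 0" if "j \<le> t" for j
      using \<rho>[OF that] by simp
    fix V A :: "'i set"
    assume V: "finite V" "card V = n"
    have norm1: "norm (w l * (\<Prod>i\<in>V. 1 + \<i> * of_real (a l) * of_real (sg A i))) \<le> ((z + 1) * real t) ^ t * 2"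
      if "l \<le> t" for l
    proof -
      have "(real l / real t)\<^sup>2 \<le> 1"
        using that assms(1) by (intro power_le_one) auto
      moreover have "(a l)\<^sup>2 = (real l / real t)\<^sup>2 / real n"
        by (simp add: a_def power_divide power_mult_distrib)
      ultimately have "(a l)\<^sup>2 \<le> 1 / real n"
        by (simp add: divide_right_mono)
      from norm_prod_imaginary_le[OF V this] show ?thesis
        unfolding norm_mult using norm_w[OF that] assms(2) by (intro mult_mono) auto
    qed
    have "\<bar>fourier \<rho> V A\<bar> \<le> eps * norm (\<Sum>l\<le>t. w l * (\<Prod>i\<in>V. 1 + \<i> * of_real (a l) * of_real (sg A i)))"
      unfolding fourier_\<rho>[OF V(1)] using assms(3) abs_Re_le_cmod by (simp add: abs_mult del: Re_sum)
    also have "\<dots> \<le> eps * (\<Sum>l\<le>t. ((z + 1) * real t) ^ t * 2)"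
      using assms(3) norm1 by (intro mult_left_mono sum_norm_le) auto
    \<comment> \<open>There are \<open>t + 1\<close> nodes and each product has norm at most
      2.\<close>
    also have "\<dots> = 2 * (eps * (real t + 1) * ((z + 1) * real t) ^ t)"
      by (simp add: algebra_simps)
    finally show "\<bar>fourier \<rho> V A\<bar> \<le> 1 / 2" using small by linarith
    \<comment> \<open>Here \<open>z^2 \<le> n\<close> makes every factor of the outlier density
      nonnegative.\<close>
    have "\<bar>z / sqrt (real n)\<bar> \<le> 1"
      using assms(2,5) by (simp add: real_le_rsqrt divide_le_eq)
    then have "\<bar>z / sqrt (real n) * sg A i\<bar> \<le> 1" for i
      by (simp add: abs_mult)
    then have "0 \<le> 1 + z / sqrt (real n) * sg A i" for i
      by (smt (verit))
    then show "0 \<le> fourier \<beta> V A"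
      unfolding fourier_\<beta>[OF V(1)] by (intro prod_nonneg) auto
  next
    fix I V :: "'i set"
    assume V: "finite I" "V \<subseteq> I" "card V = n"
    then have "finite V" by (auto intro: finite_subset)
    have "cube_exp I (\<lambda>A. (fourier \<beta> V A)\<^sup>2) = (\<Sum>B\<in>Pow V. \<beta> (card B) * \<beta> (card B))"
      unfolding power2_eq_square using cube_exp_fourier_mult[OF V(1,2,2)] by simp
    also have "\<dots> = (\<Sum>B\<in>Pow V. (z\<^sup>2 / real n) ^ card B)"
    proof -
      have "z / sqrt (real n) * (z / sqrt (real n)) = z\<^sup>2 / real n"
        by (simp add: power2_eq_square)
      then show ?thesis by (simp only: \<beta>_def power_mult_distrib[symmetric])
    qed
    also have "\<dots> = (1 + z\<^sup>2 / real n) ^ n"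
      using sum_Pow_power_card[OF \<open>finite V\<close>] V(3) by simp
    also have "\<dots> \<le> exp (real n * (z\<^sup>2 / real n))"
      by (rule one_plus_power_le_exp) simp
    also have "\<dots> = exp (z\<^sup>2)" using assms(4) by simp
    finally show "cube_exp I (\<lambda>A. (fourier \<beta> V A)\<^sup>2) \<le> exp (z\<^sup>2)" .
  qed
qed

section \<open>Distributions carried by the cube\<close>

abbreviation cube_index :: "nat \<Rightarrow> nat \<Rightarrow> (nat \<times> nat) set" where
  "cube_index d N \<equiv> {..<d} \<times> {..<N}"

text \<open>The function is restricted because points of \<open>Rd d\<close> are extensional.
  Scaling gives each coordinate variance 1 under the uniform law, while a large \<open>N\<close>
  leaves room for \<open>z^2 \<le> k * N\<close> even if \<open>k\<close> is small.\<close>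

definition coord_map :: "nat \<Rightarrow> nat \<Rightarrow> (nat \<times> nat) set \<Rightarrow> nat \<Rightarrow> real" where
  "coord_map d N A = (\<lambda>i\<in>{..<d}. (\<Sum>j<N. sg A (i, j)) / sqrt (real N))"

text \<open>\<open>g\<close> is a density relative to the uniform law on the cube, which is then
  pushed forward. The support is finite, so every integral becomes a
  \<open>cube_exp\<close>.\<close>

definition cube_law :: "nat \<Rightarrow> nat \<Rightarrow> ((nat \<times> nat) set \<Rightarrow> real) \<Rightarrow> (nat \<Rightarrow> real) measure" where
  "cube_law d N g =
     distr (point_measure (Pow (cube_index d N)) (\<lambda>A. ennreal (g A / 2 ^ card (cube_index d N))))
       (Rd d) (coord_map d N)"

lemma space_Rd: "space (Rd d) = extensional {..<d}"
  by (simp add: Rd_def space_PiM PiE_def)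

lemma coord_map_in_space: "coord_map d N A \<in> space (Rd d)"
  by (auto simp: space_Rd coord_map_def)

lemma sets_cube_law [simp, measurable_cong]: "sets (cube_law d N g) = sets (Rd d)"
  by (simp add: cube_law_def)

lemma space_cube_law [simp]: "space (cube_law d N g) = space (Rd d)"
  by (simp add: cube_law_def)

lemma measurable_coord_map:
  "coord_map d N \<in> measurable (point_measure (Pow (cube_index d N)) w) (Rd d)"
  by (simp add: measurable_point_measure_eq1 coord_map_in_space)

lemma emeasure_cube_law:
  assumes "\<And>A. A \<subseteq> cube_index d N \<Longrightarrow> 0 \<le> g A" "E \<in> sets (Rd d)"
  shows "emeasure (cube_law d N g) E =
    ennreal (cube_exp (cube_index d N) (\<lambda>A. g A * indicator E (coord_map d N A)))"
proof -
  let ?I = "cube_index d N"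
  let ?w = "\<lambda>A. ennreal (g A / 2 ^ card ?I)"
  have "emeasure (cube_law d N g) E =
      emeasure (point_measure (Pow ?I) ?w) (coord_map d N -` E \<inter> Pow ?I)"
    unfolding cube_law_def using assms(2)
    by (subst emeasure_distr[OF measurable_coord_map]) (auto simp: space_point_measure)
  also have "\<dots> = (\<Sum>A\<in>coord_map d N -` E \<inter> Pow ?I. ?w A)"
    by (intro emeasure_point_measure_finite2) auto
  also have "\<dots> = ennreal (\<Sum>A\<in>coord_map d N -` E \<inter> Pow ?I. g A / 2 ^ card ?I)"
    using assms(1) by (intro sum_ennreal) auto
  also have "(\<Sum>A\<in>coord_map d N -` E \<inter> Pow ?I. g A / 2 ^ card ?I) =
      (\<Sum>A\<in>Pow ?I. g A * indicator E (coord_map d N A) / 2 ^ card ?I)"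
    by (intro sum.mono_neutral_cong_left) (auto simp: indicator_def)
  finally show ?thesis unfolding cube_exp_def sum_divide_distrib .
qed

lemma distr_on_cube_law:
  assumes "\<And>A. A \<subseteq> cube_index d N \<Longrightarrow> 0 \<le> g A" "cube_exp (cube_index d N) g = 1"
  shows "distr_on d (cube_law d N g)"
proof -
  have "cube_exp (cube_index d N) (\<lambda>A. g A * indicator (space (Rd d)) (coord_map d N A)) = 1"
    using assms(2) by (simp add: coord_map_in_space indicator_def cong: cube_exp_cong)
  then have "emeasure (cube_law d N g) (space (cube_law d N g)) = 1"
    using emeasure_cube_law[OF assms(1), where E = "space (Rd d)"] by simp
  then show ?thesis
    unfolding distr_on_def by (auto intro: prob_spaceI)
qed

lemma
  assumes g: "\<And>A. A \<subseteq> cube_index d N \<Longrightarrow> 0 \<le> g A" and f: "f \<in> borel_measurable (Rd d)"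
  shows integrable_cube_law: "integrable (cube_law d N g) f"
    and integral_cube_law: "(\<integral>x. f x \<partial>cube_law d N g) =
      cube_exp (cube_index d N) (\<lambda>A. g A * f (coord_map d N A))"
proof -
  let ?I = "cube_index d N"
  show "integrable (cube_law d N g) f"
    unfolding cube_law_def using f measurable_coord_map
    by (subst integrable_distr_eq) (auto intro!: integrable_point_measure_finite)
  have "(\<integral>x. f x \<partial>cube_law d N g) =
      (\<integral>A. f (coord_map d N A) \<partial>point_measure (Pow ?I) (\<lambda>A. ennreal (g A / 2 ^ card ?I)))"
    unfolding cube_law_def using f by (intro integral_distr measurable_coord_map)
  also have "\<dots> = (\<Sum>A\<in>Pow ?I. g A / 2 ^ card ?I * f (coord_map d N A))"
    using g by (subst lebesgue_integral_point_measure_finite) auto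
  finally show "(\<integral>x. f x \<partial>cube_law d N g) = cube_exp ?I (\<lambda>A. g A * f (coord_map d N A))"
    by (simp add: cube_exp_def sum_divide_distrib del: card_SigmaI)
qed

lemma mixture_cube_law:
  assumes "\<And>A. A \<subseteq> cube_index d N \<Longrightarrow> 0 \<le> p A" "\<And>A. A \<subseteq> cube_index d N \<Longrightarrow> 0 \<le> b A"
    and "0 \<le> eps" "eps \<le> 1"
  shows "mixture eps (cube_law d N p) (cube_law d N b) =
    cube_law d N (\<lambda>A. (1 - eps) * p A + eps * b A)"
proof -
  let ?I = "cube_index d N" and ?m = "\<lambda>A. (1 - eps) * p A + eps * b A"
  have m: "0 \<le> ?m A" if "A \<subseteq> ?I" for A
    using assms that by (intro add_nonneg_nonneg mult_nonneg_nonneg) auto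
  have "ennreal (1 - eps) * emeasure (cube_law d N p) E + ennreal eps * emeasure (cube_law d N b) E =
      emeasure (cube_law d N ?m) E" if "E \<in> sets (Rd d)" for E
  proof -
    let ?c = "\<lambda>g. cube_exp ?I (\<lambda>A. g A * indicator E (coord_map d N A))"
    have nn: "0 \<le> ?c p" "0 \<le> ?c b"
      using assms by (auto intro!: cube_exp_nonneg)
    have "?c ?m = (1 - eps) * ?c p + eps * ?c b"
      unfolding cube_exp_scale[symmetric] cube_exp_add[symmetric] by (simp add: algebra_simps)
    then show ?thesis
      using assms nn that
      by (simp add: emeasure_cube_law m ennreal_mult ennreal_plus)
  qed
  \<comment> \<open>\<open>mixture\<close> is built by \<open>measure_of\<close>, for which
    agreement of the set functions on the measurable sets suffices.\<close>
  then have "mixture eps (cube_law d N p) (cube_law d N b) =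
      measure_of (space (cube_law d N ?m)) (sets (cube_law d N ?m)) (emeasure (cube_law d N ?m))"
    unfolding mixture_def using sets.sigma_sets_eq[of "Rd d"] sets.space_closed[of "Rd d"]
    by (simp, intro measure_of_eq) auto
  then show ?thesis by (simp only: measure_of_of_measure)
qed

lemma coord_map_apply: "i < d \<Longrightarrow> coord_map d N A i = (\<Sum>j<N. sg A (i, j)) / sqrt (real N)"
  by (simp add: coord_map_def)

lemma measurable_Rd_coord: "i < d \<Longrightarrow> (\<lambda>x. x i) \<in> borel_measurable (Rd d)"
  unfolding Rd_def by (rule measurable_component_singleton) simp

text \<open>The mean depends on \<open>g\<close> only through its Fourier coefficients of level
  1.\<close>

lemma mean_vec_cube_law:
  assumes "\<And>A. A \<subseteq> cube_index d N \<Longrightarrow> 0 \<le> g A" "i < d"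
  shows "mean_vec d (cube_law d N g) i =
    (\<Sum>j<N. cube_exp (cube_index d N) (\<lambda>A. g A * sg A (i, j))) / sqrt (real N)"
proof -
  have "mean_vec d (cube_law d N g) i =
      cube_exp (cube_index d N) (\<lambda>A. g A * ((\<Sum>j<N. sg A (i, j)) / sqrt (real N)))"
    unfolding mean_vec_def using assms measurable_Rd_coord
    by (simp add: integral_cube_law coord_map_apply)
  also have "\<dots> = cube_exp (cube_index d N) (\<lambda>A. (1 / sqrt (real N)) * (\<Sum>j<N. g A * sg A (i, j)))"
    unfolding sum_distrib_left[symmetric] by (simp add: mult_ac)
  finally show ?thesis unfolding cube_exp_scale cube_exp_sum by simp
qed

lemma vnorm_nonneg [simp]: "0 \<le> vnorm d u"
  by (simp add: vnorm_def sum_nonneg)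

lemma vnorm_square: "(vnorm d u)\<^sup>2 = (\<Sum>i<d. (u i)\<^sup>2)"
  by (simp add: vnorm_def sum_nonneg)

text \<open>Here \<open>v\<close> is to be an estimate that is close to both means \<open>u\<close>
  and \<open>w\<close>.\<close>

lemma vnorm_triangle: "vnorm d (\<lambda>i. u i - w i) \<le> vnorm d (\<lambda>i. v i - u i) + vnorm d (\<lambda>i. v i - w i)"
proof -
  have "vnorm d (\<lambda>i. u i - w i) = L2_set (\<lambda>i. (u i - v i) + (v i - w i)) {..<d}"
    by (simp add: vnorm_def L2_set_def)
  also have "\<dots> \<le> L2_set (\<lambda>i. u i - v i) {..<d} + L2_set (\<lambda>i. v i - w i) {..<d}"
    by (rule L2_set_triangle_ineq)
  also have "L2_set (\<lambda>i. u i - v i) {..<d} = vnorm d (\<lambda>i. v i - u i)"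
    by (simp add: vnorm_def L2_set_def power2_commute)
  finally show ?thesis by (simp add: vnorm_def L2_set_def)
qed

text \<open>The quotient is a product of \<open>m\<close> factors, each at most
  \<open>2 * m\<close>.\<close>

lemma fact_double_le: "fact (2 * m) / fact m \<le> (2 * real m) ^ m"
proof -
  have "real (fact (2 * m) div fact (2 * m - m)) \<le> real ((2 * m) ^ m)"
    by (intro of_nat_mono fact_div_fact_le_pow) simp
  then show ?thesis by (simp add: real_of_nat_div fact_dvd)
qed

section \<open>Centered moments under a density at most 2\<close>

context
  fixes d N :: nat and g :: "(nat \<times> nat) set \<Rightarrow> real" and \<mu> :: "nat \<Rightarrow> real"
  assumes N: "N \<ge> 1"
    and g_nonneg: "\<And>A. A \<subseteq> cube_index d N \<Longrightarrow> 0 \<le> g A"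
    and g_le: "\<And>A. A \<subseteq> cube_index d N \<Longrightarrow> g A \<le> 2"
    and g_mass: "cube_exp (cube_index d N) g = 1"
    and \<mu>: "(\<Sum>i<d. (\<mu> i)\<^sup>2) \<le> 1"
begin

abbreviation "centered A v \<equiv> ip d (\<lambda>i. coord_map d N A i - \<mu> i) v"

lemma centered_eq:
  "centered A v = (\<Sum>(i, j)\<in>cube_index d N. sg A (i, j) * (v i / sqrt (real N))) - (\<Sum>i<d. \<mu> i * v i)"
proof -
  have "centered A v = (\<Sum>i<d. \<Sum>j<N. sg A (i, j) * (v i / sqrt (real N))) - (\<Sum>i<d. \<mu> i * v i)"
    by (simp add: ip_def coord_map_apply left_diff_distrib sum_subtractf sum_distrib_right
        sum_divide_distrib)
  then show ?thesis by (simp add: sum.cartesian_product)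
qed

lemma poly_fun_centered: "poly_fun d 1 (\<lambda>v. centered A v)"
  unfolding ip_def by (rule poly_fun_linear)

text \<open>The linear forms attached to the signs have squares adding up to \<open>|v|^2\<close>.
  The shift by \<open>\<mu>\<close> adds at most as much by Cauchy-Schwarz, hence the factor
  \<open>2 ^ m\<close>.\<close>

lemma sos_centered_moment:
  "sos_form d m (\<lambda>v. fact (2 * m) / fact m * 2 ^ m * (\<Sum>i<d. (v i)\<^sup>2) ^ m -
     cube_exp (cube_index d N) (\<lambda>A. centered A v ^ (2 * m)))"
proof -
  let ?c = "fact (2 * m) / fact m :: real" and ?b = "\<lambda>v. \<Sum>i<d. \<mu> i * v i"
  let ?S = "\<lambda>v :: nat \<Rightarrow> real. \<Sum>i<d. (v i)\<^sup>2"
  let ?a = "\<lambda>(i, j :: nat) v. v i / sqrt (real N)"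
  have a: "poly_fun d 1 (?a p)" if "p \<in> cube_index d N" for p
    using that poly_fun_scale[OF poly_fun_coord, of _ d "1 / sqrt (real N)"] by auto
  have norm: "(\<Sum>p\<in>cube_index d N. (?a p v)\<^sup>2) = ?S v" for v
  proof -
    have "(\<Sum>p\<in>cube_index d N. (?a p v)\<^sup>2) = (\<Sum>i<d. \<Sum>j<N. (v i)\<^sup>2 / real N)"
      unfolding sum.cartesian_product by (intro sum.cong) (auto simp: power_divide)
    then show ?thesis using N by simp
  qed
  have centered: "(\<Sum>p\<in>cube_index d N. sg A p * ?a p v) - ?b v = centered A v" for A v
    by (simp add: centered_eq case_prod_beta)
  have "sos_form d m (\<lambda>v. ?c * ((\<Sum>p\<in>cube_index d N. (?a p v)\<^sup>2) + (?b v)\<^sup>2) ^ m -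
      cube_exp (cube_index d N) (\<lambda>A. ((\<Sum>p\<in>cube_index d N. sg A p * ?a p v) - ?b v) ^ (2 * m)))"
    by (rule sos_cube_shifted_even_moment[OF _ a poly_fun_linear]) auto
  then have 1: "sos_form d m (\<lambda>v. ?c * (?S v + (?b v)\<^sup>2) ^ m -
      cube_exp (cube_index d N) (\<lambda>A. centered A v ^ (2 * m)))"
    by (simp only: norm centered)
  have "sos_form d (1 * m) (\<lambda>v. (2 * ?S v) ^ m - (?S v + (?b v)\<^sup>2) ^ m)"
    using sos_form_cauchy_schwarz[OF \<mu>]
    by (intro sos_form_power_diff sos_form_scale sos_form_add sos_form_norm sos_form_square
        poly_fun_linear) auto
  then have 2: "sos_form d m (\<lambda>v. ?c * ((2 * ?S v) ^ m - (?S v + (?b v)\<^sup>2) ^ m))"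
    by (intro sos_form_scale) auto
  show ?thesis
    using sos_form_add[OF 1 2] by (simp add: algebra_simps power_mult_distrib)
qed

text \<open>Odd orders are reduced to the order \<open>2 * i\<close> by
  \<open>2 * x \<le> s + x^2 / s\<close> with \<open>s = sqrt i ^ i\<close>; the factor 2 pays for
  the density bound.\<close>

lemma cube_centered_moment_le:
  assumes "vnorm d v = 1" "i \<ge> 1"
  shows "cube_exp (cube_index d N) (\<lambda>A. g A * \<bar>centered A v\<bar> ^ i) \<le> (8 * sqrt (real i)) ^ i"
proof -
  let ?I = "cube_index d N" and ?s = "sqrt (real i) ^ i"
  have s: "?s > 0" using assms(2) by simp
  have "0 \<le> fact (2 * i) / fact i * 2 ^ i * (\<Sum>i<d. (v i)\<^sup>2) ^ i -
      cube_exp ?I (\<lambda>A. centered A v ^ (2 * i))"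
    by (rule sos_form_nonneg[OF sos_centered_moment])
  then have "cube_exp ?I (\<lambda>A. centered A v ^ (2 * i)) \<le> fact (2 * i) / fact i * 2 ^ i"
    using assms(1) by (simp flip: vnorm_square)
  also have "\<dots> \<le> (2 * real i) ^ i * 2 ^ i"
    by (intro mult_right_mono fact_double_le) simp
  also have "\<dots> = 4 ^ i * (?s * ?s)"
  proof -
    have "?s * ?s = real i ^ i" by (simp only: power_mult_distrib[symmetric]) simp
    moreover have "(2 * real i) ^ i * 2 ^ i = (4 * real i) ^ i" by (simp only: power_mult_distrib[symmetric]) simp
    ultimately show ?thesis by (simp only: power_mult_distrib)
  qed
  finally have even: "cube_exp ?I (\<lambda>A. centered A v ^ (2 * i)) \<le> 4 ^ i * (?s * ?s)" .
  have "cube_exp ?I (\<lambda>A. g A * \<bar>centered A v\<bar> ^ i) \<le>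
      cube_exp ?I (\<lambda>A. ?s + (1 / ?s) * centered A v ^ (2 * i))"
  proof (rule cube_exp_mono)
    fix A assume A: "A \<subseteq> ?I"
    let ?x = "\<bar>centered A v\<bar> ^ i"
    have amgm: "2 * x \<le> s + (1 / s) * (x * x)" if "s > 0" for x s :: real
    proof -
      have "0 \<le> (s - x)\<^sup>2 / s" using that by simp
      also have "\<dots> = s + (1 / s) * (x * x) - 2 * x"
        using that by (simp add: power2_eq_square field_simps)
      finally show ?thesis by simp
    qed
    have "?x * ?x = (\<bar>centered A v\<bar> * \<bar>centered A v\<bar>) ^ i"
      by (rule power_mult_distrib[symmetric])
    then have "?x * ?x = centered A v ^ (2 * i)"
      by (simp only: abs_mult_self_eq power_mult power2_eq_square)
    with amgm[OF s, of ?x] have "2 * ?x \<le> ?s + (1 / ?s) * centered A v ^ (2 * i)" by (simp only:)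
    moreover have "g A * ?x \<le> 2 * ?x"
      using g_le[OF A] by (intro mult_right_mono) auto
    ultimately show "g A * ?x \<le> ?s + (1 / ?s) * centered A v ^ (2 * i)" by linarith
  qed
  also have "\<dots> = ?s + (1 / ?s) * cube_exp ?I (\<lambda>A. centered A v ^ (2 * i))"
    unfolding cube_exp_add cube_exp_scale by (simp add: cube_exp_const)
  also have "\<dots> \<le> ?s + (1 / ?s) * (4 ^ i * (?s * ?s))"
    using s even by (intro add_left_mono mult_left_mono) auto
  also have "\<dots> = (1 + 4 ^ i) * ?s"
  proof -
    have "y + (1 / y) * (b * (y * y)) = (1 + b) * y" if "y > 0" for y b :: real
      using that by (simp add: algebra_simps)
    from this[OF s] show ?thesis .
  qed
  also have "\<dots> \<le> 8 ^ i * ?s"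
  proof (rule mult_right_mono)
    have "(1 :: real) + 4 ^ i \<le> 2 * 4 ^ i" by simp
    also have "\<dots> \<le> 2 ^ i * 4 ^ i"
      using assms(2) self_le_power[of "2 :: real" i] by (intro mult_right_mono) auto
    finally show "(1 :: real) + 4 ^ i \<le> 8 ^ i" by (simp only: power_mult_distrib[symmetric]) simp
  qed simp
  finally show ?thesis by (simp add: power_mult_distrib)
qed

text \<open>By Jensen's inequality it suffices to bound the moment of order \<open>2t\<close>; each step of the
  bound holds with a sum of squares as the difference of its two sides.\<close>
lemma sos_proof_centered_moment:
  assumes "t \<ge> 1"
  shows "sos_proof d (2 * t) (\<lambda>v. (8 * real t) ^ t -
    (cube_exp (cube_index d N) (\<lambda>A. g A * centered A v ^ t))\<^sup>2)"
proof -
  let ?I = "cube_index d N" and ?S = "\<lambda>v :: nat \<Rightarrow> real. \<Sum>i<d. (v i)\<^sup>2"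
  define Q :: real where "Q = 2 * (fact (2 * t) / fact t * 2 ^ t)"
  define F where "F v = cube_exp ?I (\<lambda>A. g A * centered A v ^ t)" for v
  define G where "G v = cube_exp ?I (\<lambda>A. g A * centered A v ^ (2 * t))" for v
  define H where "H v = cube_exp ?I (\<lambda>A. centered A v ^ (2 * t))" for v
  have poly: "poly_fun d t (\<lambda>v. centered A v ^ t)" for A
    using poly_fun_power[OF poly_fun_centered] by simp
  have poly_F: "poly_fun d t F"
    unfolding F_def by (intro poly_fun_cube_exp poly)
  \<comment> \<open>Jensen's inequality as a variance under \<open>g\<close>, which has mass
    1.\<close>
  have jensen: "G v - (F v)\<^sup>2 = cube_exp ?I (\<lambda>A. g A * (centered A v ^ t + (- 1) * F v)\<^sup>2)" for v
  proof -
    have "cube_exp ?I (\<lambda>A. g A * (centered A v ^ t + (- 1) * F v)\<^sup>2) =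
        cube_exp ?I (\<lambda>A. (g A * centered A v ^ (2 * t) + (F v)\<^sup>2 * g A) -
          (2 * F v) * (g A * centered A v ^ t))"
    proof (intro cube_exp_cong)
      fix A
      have "centered A v ^ (2 * t) = centered A v ^ t * centered A v ^ t"
        by (simp only: mult_2 power_add)
      then show "g A * (centered A v ^ t + (- 1) * F v)\<^sup>2 =
          (g A * centered A v ^ (2 * t) + (F v)\<^sup>2 * g A) - (2 * F v) * (g A * centered A v ^ t)"
        by (simp only: power2_eq_square) (simp add: algebra_simps)
    qed
    also have "\<dots> = G v + (F v)\<^sup>2 * 1 - 2 * F v * F v"
      unfolding cube_exp_diff cube_exp_add cube_exp_scale g_mass G_def F_def ..
    finally show ?thesis by (simp add: power2_eq_square)
  qed
  have 1: "sos_form d t (\<lambda>v. G v - (F v)\<^sup>2)"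
    unfolding jensen using g_nonneg
    by (intro sos_form_cube_exp poly_fun_add poly poly_fun_scale poly_F)
  have dens: "2 * H v - G v = cube_exp ?I (\<lambda>A. (2 - g A) * (centered A v ^ t)\<^sup>2)" for v
    unfolding H_def G_def cube_exp_scale[symmetric] cube_exp_diff[symmetric]
    by (intro cube_exp_cong) (simp add: left_diff_distrib power_even_eq)
  have 2: "sos_form d t (\<lambda>v. 2 * H v - G v)"
    unfolding dens using g_le by (intro sos_form_cube_exp poly) auto
  have 3: "sos_form d t (\<lambda>v. 2 * (Q / 2 * ?S v ^ t - H v))"
    using sos_centered_moment[of t] unfolding H_def Q_def by (intro sos_form_scale) auto
  have "Q \<le> 2 * ((2 * real t) ^ t * 2 ^ t)"
    unfolding Q_def by (intro mult_left_mono mult_right_mono fact_double_le) auto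
  also have "\<dots> \<le> 2 ^ t * ((2 * real t) ^ t * 2 ^ t)"
    using assms self_le_power[of "2 :: real" t] by (intro mult_right_mono) auto
  also have "\<dots> = (8 * real t) ^ t" by (simp only: power_mult_distrib[symmetric]) simp
  finally have 4: "sos_form d t (\<lambda>v. (8 * real t) ^ t - Q)"
    by (intro sos_form_const) simp
  have Q: "Q \<ge> 0" by (simp add: Q_def)
  have "sos_form d (t - 1) (\<lambda>v. ?S v ^ j)" if "j < t" for j
    using sos_form_power[OF sos_form_norm, of d j] that by (auto intro: sos_form_mono)
  then have mult: "sos_form d (t - 1) (\<lambda>v. Q * (\<Sum>j<t. ?S v ^ j))"
    using Q by (intro sos_form_scale sos_form_sum) auto
  have "sos_proof d (2 * t) (\<lambda>v. (8 * real t) ^ t - (F v)\<^sup>2)"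
  proof (rule sos_proof_from_form)
    show "sos_form d (2 * t div 2) (\<lambda>v. (G v - (F v)\<^sup>2) + (2 * H v - G v) +
        2 * (Q / 2 * ?S v ^ t - H v) + ((8 * real t) ^ t - Q))"
      using sos_form_add[OF sos_form_add[OF sos_form_add[OF 1 2] 3] 4] by simp
    show "sos_form d ((2 * t - 2) div 2) (\<lambda>v. Q * (\<Sum>j<t. ?S v ^ j))"
    proof -
      have "(2 * t - 2) div 2 = t - 1" by simp
      then show ?thesis using mult by simp
    qed
    fix v
    \<comment> \<open>The geometric sum splits the axiom polynomial off \<open>1 - ?S v ^ t\<close>
      and fits into the remaining degree.\<close>
    have "(1 - ?S v) * (\<Sum>j<t. ?S v ^ j) = 1 - ?S v ^ t"
      by (rule one_diff_power_eq[symmetric])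
    then have "Q * (\<Sum>j<t. ?S v ^ j) * (1 - ?S v) = Q * (1 - ?S v ^ t)"
      by (simp only: mult_ac)
    then show "(8 * real t) ^ t - (F v)\<^sup>2 = (G v - (F v)\<^sup>2) + (2 * H v - G v) +
        2 * (Q / 2 * ?S v ^ t - H v) + ((8 * real t) ^ t - Q) +
        Q * (\<Sum>j<t. ?S v ^ j) * (1 - ?S v)"
      by (simp only:) (simp add: algebra_simps)
  qed (use assms in simp)
  then show ?thesis by (simp only: F_def)
qed

end

lemma ip_commute: "ip d u v = ip d v u"
  by (simp add: ip_def mult.commute)

text \<open>Tails and the moment certificate are inherited from the uniform cube by any density at
  most 2; only sparsity and norm of the mean are special to \<open>g\<close>.\<close>

lemma class_P_cube_law:
  fixes g :: "(nat \<times> nat) set \<Rightarrow> real"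
  assumes "N \<ge> 1" "t \<ge> 1"
    and g_nonneg: "\<And>A. A \<subseteq> cube_index d N \<Longrightarrow> 0 \<le> g A"
    and g_le: "\<And>A. A \<subseteq> cube_index d N \<Longrightarrow> g A \<le> 2"
    and g_mass: "cube_exp (cube_index d N) g = 1"
    and sparse: "card {i. i < d \<and> mean_vec d (cube_law d N g) i \<noteq> 0} \<le> k"
    and norm: "vnorm d (mean_vec d (cube_law d N g)) \<le> 1"
  shows "class_P 8 8 2 d k t (cube_law d N g)"
proof -
  let ?P = "cube_law d N g"
  let ?\<mu> = "mean_vec d ?P"
  have mu: "(\<Sum>i<d. (?\<mu> i)\<^sup>2) \<le> 1"
    using norm unfolding vnorm_square[symmetric] by (simp add: power_le_one)
  note facts = assms(1) g_nonneg g_le g_mass mu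
  have meas: "(\<lambda>x. ip d (\<lambda>j. x j - ?\<mu> j) v) \<in> borel_measurable (Rd d)" for v
    unfolding ip_def
    by (intro borel_measurable_sum borel_measurable_times borel_measurable_diff measurable_Rd_coord)
      auto
  show ?thesis
    unfolding class_P_def
  proof (intro conjI allI impI)
    show "distr_on d ?P" using g_nonneg g_mass by (rule distr_on_cube_law)
    show "integrable ?P (\<lambda>x. x i)" if "i < d" for i
      using g_nonneg measurable_Rd_coord[OF that] by (rule integrable_cube_law)
    fix v and i :: nat assume v: "vnorm d v = 1" and i: "1 \<le> i"
    have m: "(\<lambda>x. \<bar>ip d v (\<lambda>j. x j - ?\<mu> j)\<bar> ^ i) \<in> borel_measurable (Rd d)"
      unfolding ip_commute[of d v] using meas by (intro borel_measurable_power borel_measurable_abs)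
    show "integrable ?P (\<lambda>x. \<bar>ip d v (\<lambda>j. x j - ?\<mu> j)\<bar> ^ i)"
      using g_nonneg m by (rule integrable_cube_law)
    have "(\<integral>x. \<bar>ip d v (\<lambda>j. x j - ?\<mu> j)\<bar> ^ i \<partial>?P) =
        cube_exp (cube_index d N) (\<lambda>A. g A * \<bar>ip d v (\<lambda>j. coord_map d N A j - ?\<mu> j)\<bar> ^ i)"
      using g_nonneg m by (rule integral_cube_law)
    also have "\<dots> \<le> (8 * sqrt (real i)) ^ i"
      unfolding ip_commute[of d v] using facts v i by (rule cube_centered_moment_le)
    finally have "root i (\<integral>x. \<bar>ip d v (\<lambda>j. x j - ?\<mu> j)\<bar> ^ i \<partial>?P) \<le> root i ((8 * sqrt (real i)) ^ i)"
      using i by (intro real_root_le_mono) auto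
    also have "\<dots> = 8 * sqrt (real i)"
      using i by (intro real_root_power_cancel) auto
    finally show "root i (\<integral>x. \<bar>ip d v (\<lambda>j. x j - ?\<mu> j)\<bar> ^ i \<partial>?P) \<le> 8 * sqrt (real i)" .
  next
    have "(\<integral>x. ip d (\<lambda>j. x j - ?\<mu> j) v ^ t \<partial>?P) =
        cube_exp (cube_index d N) (\<lambda>A. g A * ip d (\<lambda>j. coord_map d N A j - ?\<mu> j) v ^ t)" for v
      using g_nonneg meas by (intro integral_cube_law borel_measurable_power)
    then show "sos_proof d (2 * t)
        (\<lambda>v. (8 * real t) ^ t - (\<integral>x. ip d (\<lambda>j. x j - ?\<mu> j) v ^ t \<partial>?P)\<^sup>2)"
      using sos_proof_centered_moment[OF facts assms(2)] by simp
  qed (use sparse norm in auto)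
qed

section \<open>Sparse sets with small intersections\<close>

lemma card_PiE_agreeing:
  assumes "f \<in> PiE {..<k} (\<lambda>_. {..<D})" "A \<subseteq> {..<k}"
  shows "card {g \<in> PiE {..<k} (\<lambda>_. {..<D}). \<forall>i\<in>A. g i = f i} = D ^ (k - card A)"
proof -
  have "{g \<in> PiE {..<k} (\<lambda>_. {..<D}). \<forall>i\<in>A. g i = f i} =
      PiE {..<k} (\<lambda>i. if i \<in> A then {f i} else {..<D})"
    using assms by (auto simp: PiE_def Pi_def extensional_def split: if_splits)
  then have "card {g \<in> PiE {..<k} (\<lambda>_. {..<D}). \<forall>i\<in>A. g i = f i} =
      (\<Prod>i<k. if i \<in> A then 1 else D)"
    by (simp add: card_PiE if_distrib cong: if_cong)
  also have "\<dots> = (\<Prod>i\<in>{..<k} - A. D)"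
    by (intro prod.mono_neutral_cong_right) auto
  also have "\<dots> = D ^ (k - card A)"
    using assms(2) by (simp add: card_Diff_subset finite_subset)
  finally show ?thesis .
qed

text \<open>The Gilbert--Varshamov argument: balls of Hamming radius \<open>k - s\<close> around the words of a
  maximal code cover all words.\<close>
lemma exists_code:
  assumes "s \<le> k" "D \<ge> 1"
  obtains F where "F \<subseteq> PiE {..<k} (\<lambda>_. {..<D :: nat})"
    "\<And>f g. f \<in> F \<Longrightarrow> g \<in> F \<Longrightarrow> f \<noteq> g \<Longrightarrow> card {i. i < k \<and> f i = g i} < s"
    "D ^ s \<le> card F * (k choose s)"
proof -
  define \<Omega> where "\<Omega> = PiE {..<k} (\<lambda>_. {..<D})"
  define code where "code F \<longleftrightarrow> (\<forall>f\<in>F. \<forall>g\<in>F. f \<noteq> g \<longrightarrow> card {i. i < k \<and> f i = g i} < s)" for F :: "(nat \<Rightarrow> nat) set"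
  have fin: "finite \<Omega>" by (simp add: \<Omega>_def finite_PiE)
  then have "finite {F \<in> Pow \<Omega>. code F}" by simp
  moreover have "{F \<in> Pow \<Omega>. code F} \<noteq> {}" by (auto simp: code_def intro!: exI[of _ "{}"])
  ultimately obtain F where F: "F \<subseteq> \<Omega>" "code F"
    and max: "\<And>G. G \<subseteq> \<Omega> \<Longrightarrow> code G \<Longrightarrow> F \<subseteq> G \<Longrightarrow> F = G"
    using finite_has_maximal[of "{F \<in> Pow \<Omega>. code F}"] by auto
  \<comment> \<open>By maximality a word outside the code cannot be added, so it agrees with some
    codeword in \<open>s\<close> places or more.\<close>
  have cover: "\<exists>f\<in>F. s \<le> card {i. i < k \<and> f i = g i}" if g: "g \<in> \<Omega>" for g
  proof (cases "g \<in> F")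
    case True
    then show ?thesis using assms(1) by (intro bexI[of _ g]) auto
  next
    case False
    then have "\<not> code (insert g F)" using max[of "insert g F"] g F(1) by blast
    moreover have "card {i. i < k \<and> g i = f i} = card {i. i < k \<and> f i = g i}" for f
      by (rule arg_cong[of _ _ card]) auto
    ultimately show ?thesis using F(2) unfolding code_def
      by (auto simp: not_less)
  qed
  let ?B = "\<lambda>f A. {g \<in> \<Omega>. \<forall>i\<in>A. g i = f i}"
  let ?As = "{A. A \<subseteq> {..<k} \<and> card A = s}"
  have finA: "finite ?As" by (rule finite_subset[of _ "Pow {..<k}"]) auto
  \<comment> \<open>Agreement in at least \<open>s\<close> places is agreement on some
    \<open>s\<close>-subset, and each codeword and subset cover \<open>D ^ (k - s)\<close>
    words.\<close>
  have "\<Omega> \<subseteq> (\<Union>f\<in>F. \<Union>A\<in>?As. ?B f A)"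
  proof
    fix g assume g: "g \<in> \<Omega>"
    then obtain f where f: "f \<in> F" "s \<le> card {i. i < k \<and> f i = g i}" using cover by blast
    obtain A where "A \<subseteq> {i. i < k \<and> f i = g i}" "card A = s"
      using obtain_subset_with_card_n[OF f(2)] by blast
    then show "g \<in> (\<Union>f\<in>F. \<Union>A\<in>?As. ?B f A)"
      using f(1) g by (intro UN_I[of f] UN_I[of A]) auto
  qed
  then have "card \<Omega> \<le> card (\<Union>f\<in>F. \<Union>A\<in>?As. ?B f A)"
    using fin by (intro card_mono) (auto intro: finite_subset[of _ \<Omega>])
  also have "\<dots> \<le> (\<Sum>f\<in>F. card (\<Union>A\<in>?As. ?B f A))"
    using fin F(1) by (intro card_UN_le) (auto intro: finite_subset)
  also have "\<dots> \<le> (\<Sum>f\<in>F. \<Sum>A\<in>?As. card (?B f A))"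
    using finA by (intro sum_mono card_UN_le)
  also have "\<dots> = (\<Sum>f\<in>F. \<Sum>A\<in>?As. D ^ (k - s))"
    using F(1) by (intro sum.cong refl) (auto simp: \<Omega>_def card_PiE_agreeing)
  also have "\<dots> = card F * (k choose s) * D ^ (k - s)"
    by (simp add: n_subsets)
  finally have "D ^ s * D ^ (k - s) \<le> card F * (k choose s) * D ^ (k - s)"
    using assms(1) by (simp add: \<Omega>_def card_PiE flip: power_add)
  then have "D ^ s \<le> card F * (k choose s)"
    using assms(2) by simp
  with F show ?thesis
    unfolding code_def \<Omega>_def by (intro that[of F]) auto
qed

text \<open>The factors of the two factorials are paired as \<open>(i + 1) * (n - i)\<close>, which
  is at least \<open>n\<close>.\<close>

lemma power_self_le_fact_square: "n ^ n \<le> (fact n)\<^sup>2"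
proof -
  have "n ^ n = (\<Prod>i<n. n)" by simp
  also have "\<dots> \<le> (\<Prod>i<n. Suc i * (n - i))"
  proof (rule prod_mono, safe)
    fix i assume "i < n"
    then obtain m where "n = Suc (i + m)" using less_imp_Suc_add by blast
    then show "n \<le> Suc i * (n - i)" by simp
  qed
  also have "\<dots> = (\<Prod>i<n. Suc i) * (\<Prod>i<n. Suc (n - Suc i))"
    unfolding prod.distrib[symmetric] by (intro prod.cong) (auto simp: Suc_diff_Suc)
  also have "(\<Prod>i<n. Suc (n - Suc i)) = (\<Prod>i<n. Suc i)"
    by (rule prod.nat_diff_reindex)
  also have "(\<Prod>i<n. Suc i) = fact n"
    by (simp add: fact_prod_Suc atLeast0LessThan)
  finally show ?thesis by (simp add: power2_eq_square)
qed

lemma powr_half_le_fact: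
  assumes "s \<ge> 1"
  shows "real s powr (real s / 2) \<le> fact s"
proof -
  have "(real s powr (real s / 2))\<^sup>2 = real s ^ s"
    using assms by (simp add: powr_power powr_realpow)
  also have "\<dots> \<le> (fact s)\<^sup>2"
    using power_self_le_fact_square[of s]
    by (metis of_nat_fact of_nat_le_iff of_nat_power)
  finally show ?thesis by (rule power2_le_imp_le) simp
qed

text \<open>Since \<open>k choose s\<close> is at most \<open>k ^ s / s!\<close>, the covering bound
  gives \<open>M \<ge> s! * q ^ s\<close> with \<open>q = D / k\<close>, while
  \<open>d \<le> 2 * k^2 * q\<close>. The growth in \<open>k\<close> is paid for by
  \<open>s!\<close>.\<close>

lemma code_size_bound:
  fixes c :: real
  assumes "k \<ge> 2" "0 < c" "c < 1" "k \<le> D" "d < k * (D + 1)"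
    and s: "real s > real k powr c" and M: "D ^ s \<le> M * (k choose s)"
  shows "real d powr (c * real k powr c / 8) \<le> real M"
proof -
  define x where "x = real k powr c"
  define q where "q = real D / real k"
  have x: "x \<ge> 1" "x < real s" using assms by (auto simp: x_def ge_one_powr_ge_zero)
  then have s2: "s \<ge> 2" by linarith
  have q: "q \<ge> 1" using assms by (simp add: q_def)
  have "D ^ s * fact s \<le> M * ((k choose s) * fact s)"
    using M by (metis mult.assoc mult_le_mono1)
  also have "\<dots> \<le> M * k ^ s"
    by (intro mult_le_mono2) (rule binomial_fact_pow)
  finally have "real (D ^ s * fact s) \<le> real (M * k ^ s)"
    by (rule of_nat_mono)
  then have size: "fact s * q ^ s \<le> real M"
    using assms(1) by (simp add: q_def power_divide field_simps)
  have "d \<le> 2 * (k * D)"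
  proof -
    have "k * 1 \<le> k * D" using assms(1,4) by (intro mult_le_mono2) linarith
    moreover have "d < k * D + k" using assms(5) by (simp add: algebra_simps)
    ultimately show ?thesis by linarith
  qed
  then have d: "real d \<le> 2 * real k ^ 2 * q"
    using assms(1) of_nat_mono[of d "2 * (k * D)"] by (simp add: q_def power2_eq_square)
  have e: "0 \<le> c * x / 8" "c * x / 8 \<le> real s / 8" "c * x / 8 \<le> real s"
    using assms x mult_mono[of c 1 x "real s"] by auto
  have "real d powr (c * x / 8) \<le> (2 * real k ^ 2 * q) powr (c * x / 8)"
    using d e by (intro powr_mono2) auto
  \<comment> \<open>The power of \<open>k\<close> becomes \<open>x powr (x / 4)\<close> because
    \<open>x = k powr c\<close>. The first two factors will be at most
    \<open>s powr (3 * s / 8)\<close>, within reach of the factorial.\<close>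
  also have "\<dots> = 2 powr (c * x / 8) * x powr (x / 4) * q powr (c * x / 8)"
    using assms(1) q by (simp add: powr_mult x_def powr_powr flip: powr_numeral)
  also have "\<dots> \<le> real s powr (real s / 8) * real s powr (real s / 4) * q ^ s"
  proof (intro mult_mono)
    have "2 powr (c * x / 8) \<le> real s powr (c * x / 8)"
      using s2 e by (intro powr_mono2) auto
    also have "\<dots> \<le> real s powr (real s / 8)"
      using s2 e by (intro powr_mono) auto
    finally show "2 powr (c * x / 8) \<le> real s powr (real s / 8)" .
    have "x powr (x / 4) \<le> real s powr (x / 4)"
      using x by (intro powr_mono2) auto
    also have "\<dots> \<le> real s powr (real s / 4)"
      using x s2 by (intro powr_mono) auto
    finally show "x powr (x / 4) \<le> real s powr (real s / 4)" .
    have "q powr (c * x / 8) \<le> q powr real s"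
      using q e by (intro powr_mono) auto
    then show "q powr (c * x / 8) \<le> q ^ s" using q by (simp add: powr_realpow)
  qed (use q in auto)
  also have "real s powr (real s / 8) * real s powr (real s / 4) = real s powr (real s / 8 + real s / 4)"
    by (rule powr_add[symmetric])
  also have "\<dots> * q ^ s \<le> real s powr (real s / 2) * q ^ s"
    using s2 q by (intro mult_right_mono powr_mono) auto
  also have "\<dots> \<le> fact s * q ^ s"
    using s2 q by (intro mult_right_mono powr_half_le_fact) auto
  finally show ?thesis using size by (simp add: x_def)
qed

text \<open>A codeword \<open>f\<close> becomes the set of the elements \<open>i * D + f i\<close>,
  one in each of \<open>k\<close> blocks of length \<open>D\<close>, so common elements are places
  of agreement.\<close>

lemma exists_sparse_family:
  fixes c :: real
  assumes "k \<ge> 1" "real k \<le> sqrt (real d)" "0 < c" "c < 1"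
  obtains F where "finite F" "\<And>S. S \<in> F \<Longrightarrow> S \<subseteq> {..<d}" "\<And>S. S \<in> F \<Longrightarrow> card S = k"
    "\<And>S T. S \<in> F \<Longrightarrow> T \<in> F \<Longrightarrow> S \<noteq> T \<Longrightarrow> real (card (S \<inter> T)) \<le> real k powr c"
    "real d powr (c * real k powr c / 8) \<le> real (card F)"
proof (cases "k = 1")
  case True
  have d: "d \<ge> 1" using assms(2) True by (cases d) auto
  let ?F = "(\<lambda>i. {i}) ` {..<d}"
  show ?thesis
  proof (rule that[of ?F])
    have "real d powr (c * 1 / 8) \<le> real d powr 1"
      using d assms by (intro powr_mono) auto
    then show "real d powr (c * real k powr c / 8) \<le> real (card ?F)"
      using True d by (simp add: card_image)
    fix S T assume "S \<in> ?F" "T \<in> ?F" "S \<noteq> T"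
    then have "S \<inter> T = {}" by auto
    then show "real (card (S \<inter> T)) \<le> real k powr c" by simp
  qed (use True in auto)
next
  case False
  then have k2: "k \<ge> 2" using assms(1) by simp
  define D where "D = d div k"
  \<comment> \<open>Fewer than \<open>s\<close> agreements are at most \<open>k powr c\<close> many.
    For \<open>k = 1\<close> this \<open>s\<close> would exceed \<open>k\<close>, which is why
    singletons are treated separately.\<close>
  define s where "s = nat \<lfloor>real k powr c\<rfloor> + 1"
  have "real (k * k) \<le> real d"
    using power_mono[OF assms(2), of 2] by (simp add: power2_eq_square)
  then have "k * k \<le> d" by linarith
  then have kD: "k \<le> D" unfolding D_def using k2 by (simp add: less_eq_div_iff_mult_less_eq)
  have dD: "d < k * (D + 1)" "k * D \<le> d"
    using k2 by (auto simp: D_def dividend_less_times_div)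
  have s_gt: "real s > real k powr c" by (simp add: s_def) linarith
  have "real k powr c < real k powr 1" using k2 assms(4) by (intro powr_less_mono) auto
  then have "nat \<lfloor>real k powr c\<rfloor> < k" using k2 by (simp add: nat_less_iff floor_less_iff)
  then have sk: "s \<le> k" by (simp add: s_def)
  obtain F where F: "F \<subseteq> PiE {..<k} (\<lambda>_. {..<D})"
    "\<And>f g. f \<in> F \<Longrightarrow> g \<in> F \<Longrightarrow> f \<noteq> g \<Longrightarrow> card {i. i < k \<and> f i = g i} < s"
    "D ^ s \<le> card F * (k choose s)"
    using exists_code[OF sk, of D] kD k2 by auto
  define e where "e f i = i * D + f i" for f :: "nat \<Rightarrow> nat" and i
  have e_eq: "i = j \<and> f i = g j"
    if "e f i = e g j" "f \<in> F" "g \<in> F" "i < k" "j < k" for f g i j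
  proof -
    have "f i < D" "g j < D" using that F(1) by (auto simp: PiE_iff)
    then have "i = (e f i) div D" "j = (e g j) div D" "f i = (e f i) mod D" "g j = (e g j) mod D"
      by (auto simp: e_def)
    then show ?thesis using that(1) by metis
  qed
  have inter: "e f ` {..<k} \<inter> e g ` {..<k} = e f ` {i. i < k \<and> f i = g i}" if "f \<in> F" "g \<in> F" for f g
  proof (intro equalityI subsetI)
    fix y assume "y \<in> e f ` {..<k} \<inter> e g ` {..<k}"
    then obtain i j where "i < k" "j < k" "y = e f i" "e f i = e g j" by auto
    moreover from this have "f i = g i" using e_eq[of f i g j] that by auto
    ultimately show "y \<in> e f ` {i. i < k \<and> f i = g i}" by (intro image_eqI[of _ _ i]) auto
  next
    fix y assume "y \<in> e f ` {i. i < k \<and> f i = g i}"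
    then obtain i where i: "i < k" "f i = g i" "y = e f i" by auto
    then have "y = e g i" by (simp add: e_def)
    with i(1) have "y \<in> e g ` {..<k}" by blast
    moreover from i have "y \<in> e f ` {..<k}" by blast
    ultimately show "y \<in> e f ` {..<k} \<inter> e g ` {..<k}" by blast
  qed
  have inj_e: "inj_on (e f) {..<k}" if "f \<in> F" for f
    using e_eq[OF _ that that] by (auto simp: inj_on_def)
  have card_inter: "card (e f ` {..<k} \<inter> e g ` {..<k}) < s" if "f \<in> F" "g \<in> F" "f \<noteq> g" for f g
  proof -
    have "card (e f ` {..<k} \<inter> e g ` {..<k}) \<le> card {i. i < k \<and> f i = g i}"
      unfolding inter[OF that(1,2)] by (intro card_image_le) simp
    then show ?thesis using F(2)[OF that] by simp
  qed
  have "inj_on (\<lambda>f. e f ` {..<k}) F"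
  proof (rule inj_onI, rule ccontr)
    fix f g assume fg: "f \<in> F" "g \<in> F" "e f ` {..<k} = e g ` {..<k}" "f \<noteq> g"
    then have "card (e f ` {..<k}) < s" using card_inter[of f g] by simp
    then show False using card_image[OF inj_e[OF fg(1)]] sk by simp
  qed
  then have card_F: "card ((\<lambda>f. e f ` {..<k}) ` F) = card F" by (rule card_image)
  show ?thesis
  proof (rule that[of "(\<lambda>f. e f ` {..<k}) ` F"])
    show "finite ((\<lambda>f. e f ` {..<k}) ` F)"
      using F(1) by (intro finite_imageI) (auto intro: finite_subset finite_PiE)
    show "real d powr (c * real k powr c / 8) \<le> real (card ((\<lambda>f. e f ` {..<k}) ` F))"
      unfolding card_F by (rule code_size_bound[OF k2 assms(3,4) kD dD(1) s_gt F(3)])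
    fix S assume "S \<in> (\<lambda>f. e f ` {..<k}) ` F"
    then obtain f where f: "f \<in> F" "S = e f ` {..<k}" by auto
    show "card S = k" using card_image[OF inj_e[OF f(1)]] f by simp
    show "S \<subseteq> {..<d}"
    proof
      fix y assume "y \<in> S"
      then obtain i where i: "i < k" "y = i * D + f i" using f by (auto simp: e_def)
      then have "f i < D" using f F(1) by (auto simp: PiE_iff)
      then have "y < (i + 1) * D" using i by simp
      also have "\<dots> \<le> k * D" using i by (intro mult_right_mono) auto
      finally show "y \<in> {..<d}" using dD(2) by simp
    qed
    fix T assume "T \<in> (\<lambda>f. e f ` {..<k}) ` F" "S \<noteq> T"
    then obtain g where g: "g \<in> F" "T = e g ` {..<k}" "f \<noteq> g" using f by auto
    then have "card (S \<inter> T) \<le> nat \<lfloor>real k powr c\<rfloor>"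
      using card_inter[of f g] f by (simp add: s_def)
    also have "real (nat \<lfloor>real k powr c\<rfloor>) \<le> real k powr c" by simp
    finally show "real (card (S \<inter> T)) \<le> real k powr c" by simp
  qed
qed

section \<open>The adversary and the hidden directions\<close>

text \<open>Transcripts in which each query \<open>f\<close> is answered by \<open>E f\<close>. The
  0 after an \<open>Output\<close> is a default; validity is only claimed for transcripts with no
  earlier \<open>Output\<close>.\<close>

fun reply :: "sq_alg \<Rightarrow> (((nat \<Rightarrow> real) \<Rightarrow> real) \<Rightarrow> real) \<Rightarrow> nat \<Rightarrow> real list" where
  "reply A E 0 = []"
| "reply A E (Suc n) =
     reply A E n @ [case A (reply A E n) of Query f tau \<Rightarrow> E f | Output _ \<Rightarrow> 0]"

lemma length_reply [simp]: "length (reply A E n) = n"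
  by (induction n) auto

lemma take_reply: "j \<le> n \<Longrightarrow> take j (reply A E n) = reply A E j"
  by (induction n) (auto simp: le_Suc_eq)

lemma nth_reply: "j < n \<Longrightarrow> A (reply A E j) = Query f tau \<Longrightarrow> reply A E n ! j = E f"
  by (induction n) (auto simp: nth_append less_Suc_eq)

lemma valid_run_reply:
  "valid_run A D (reply A E n) \<longleftrightarrow>
    (\<forall>j<n. \<exists>f tau. A (reply A E j) = Query f tau \<and> \<bar>E f - (\<integral>x. f x \<partial>D)\<bar> \<le> tau)"
  unfolding valid_run_def by (auto simp: take_reply nth_reply)

text \<open>The adversary answers all queries as for \<open>U\<close>; each answer of tolerance above \<open>T\<close> rules out
  at most \<open>\<eta>\<close> members of the family.\<close>
lemma sq_adversary:
  assumes "wf_sq_alg d A" "finite F" "0 \<le> T" "B * \<eta> < real (card F)" "0 \<le> \<eta>"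
    and few: "\<And>f tau. f \<in> borel_measurable (Rd d) \<Longrightarrow> (\<And>x. x \<in> space (Rd d) \<Longrightarrow> \<bar>f x\<bar> \<le> 1) \<Longrightarrow>
      T < tau \<Longrightarrow> real (card {S \<in> F. tau < \<bar>(\<integral>x. f x \<partial>U) - (\<integral>x. f x \<partial>D S)\<bar>}) \<le> \<eta>"
    and separated: "\<And>hs mu S. S \<in> F \<Longrightarrow> A hs = Output mu \<Longrightarrow> valid_run A U hs \<Longrightarrow>
      valid_run A (D S) hs \<Longrightarrow> False"
  shows "(\<exists>hs. valid_run A U hs \<and> real (length hs) \<ge> B) \<or>
    (\<exists>hs f tau. valid_run A U hs \<and> A hs = Query f tau \<and> tau \<le> T)"
proof (rule ccontr)
  assume contra: "\<not> ?thesis"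
  define E where "E f = (\<integral>x. f x \<partial>U)" for f :: "(nat \<Rightarrow> real) \<Rightarrow> real"
  let ?h = "reply A E"
  have valid: "valid_run A U (?h n)" if "\<And>j mu. j < n \<Longrightarrow> A (?h j) \<noteq> Output mu" for n
    using that
  proof (induction n)
    case 0
    then show ?case by (simp add: valid_run_def)
  next
    case (Suc n)
    then have IH: "valid_run A U (?h n)" by simp
    obtain f tau where q: "A (?h n) = Query f tau" using Suc.prems[of n] by (cases "A (?h n)") auto
    with IH contra have "T < tau" by force
    with q IH \<open>0 \<le> T\<close> show ?case
      unfolding valid_run_reply by (auto simp: less_Suc_eq E_def)
  qed
  \<comment> \<open>Otherwise the exact answers for \<open>U\<close> would form a valid run of at
    least \<open>B\<close> queries.\<close>
  have "\<exists>n mu. A (?h n) = Output mu \<and> real n < B"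
  proof (rule ccontr)
    assume none: "\<nexists>n mu. A (?h n) = Output mu \<and> real n < B"
    define m where "m = nat \<lceil>B\<rceil>"
    have "A (?h j) \<noteq> Output mu" if "j < m" for j mu
    proof -
      have "real j < B" using that unfolding m_def by linarith
      then show ?thesis using none by blast
    qed
    then have "valid_run A U (?h m)" by (rule valid)
    moreover have "real (length (?h m)) \<ge> B" by (simp add: m_def real_nat_ceiling_ge)
    ultimately show False using contra by blast
  qed
  then have ex: "\<exists>n. \<exists>mu. A (?h n) = Output mu \<and> real n < B" .
  define n where "n = (LEAST n. \<exists>mu. A (?h n) = Output mu \<and> real n < B)"
  obtain mu where mu: "A (?h n) = Output mu" "real n < B"
    using LeastI_ex[OF ex] unfolding n_def by blast
  have queries: "A (?h j) \<noteq> Output mu'" if "j < n" for j mu'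
    using not_less_Least[of j "\<lambda>n. \<exists>mu. A (?h n) = Output mu \<and> real n < B"] that mu(2)
    unfolding n_def[symmetric] by auto
  have valid_n: "valid_run A U (?h n)" using queries by (rule valid)
  \<comment> \<open>The members for which the answer in round \<open>j\<close> is out of tolerance.
    Fewer than \<open>B\<close> rounds cannot exhaust the family.\<close>
  define bad where "bad j = {S \<in> F. \<exists>f tau. A (?h j) = Query f tau \<and>
    tau < \<bar>(\<integral>x. f x \<partial>U) - (\<integral>x. f x \<partial>D S)\<bar>}" for j
  have "real (card (bad j)) \<le> \<eta>" if j: "j < n" for j
  proof -
    obtain f tau where q: "A (?h j) = Query f tau"
      using queries[OF j] by (cases "A (?h j)") auto
    have "valid_run A U (?h j)" using queries j by (intro valid) auto
    with q contra have "T < tau" by force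
    moreover have "f \<in> borel_measurable (Rd d)" "\<And>x. x \<in> space (Rd d) \<Longrightarrow> \<bar>f x\<bar> \<le> 1"
      using assms(1) q unfolding wf_sq_alg_def by blast+
    ultimately show ?thesis using few q by (simp add: bad_def)
  qed
  then have "(\<Sum>j<n. real (card (bad j))) \<le> real n * \<eta>"
    using sum_mono[of "{..<n}" "\<lambda>j. real (card (bad j))" "\<lambda>_. \<eta>"] by simp
  moreover have "card (\<Union>j<n. bad j) \<le> (\<Sum>j<n. card (bad j))"
    by (rule card_UN_le) simp
  moreover have "real n * \<eta> \<le> B * \<eta>" using mu(2) \<open>0 \<le> \<eta>\<close> by (intro mult_right_mono) auto
  ultimately have "card (\<Union>j<n. bad j) < card F"
    using assms(4) by (simp flip: of_nat_sum)
  moreover have "(\<Union>j<n. bad j) \<subseteq> F" by (auto simp: bad_def)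
  ultimately have "(\<Union>j<n. bad j) \<noteq> F" by auto
  then obtain S where S: "S \<in> F" "\<And>j. j < n \<Longrightarrow> S \<notin> bad j"
    using \<open>(\<Union>j<n. bad j) \<subseteq> F\<close> by blast
  have "valid_run A (D S) (?h n)"
    unfolding valid_run_reply
  proof (intro allI impI)
    fix j assume j: "j < n"
    obtain f tau where q: "A (?h j) = Query f tau"
      using queries[OF j] by (cases "A (?h j)") auto
    then show "\<exists>f tau. A (?h j) = Query f tau \<and> \<bar>E f - (\<integral>x. f x \<partial>D S)\<bar> \<le> tau"
      using S j by (force simp: bad_def E_def)
  qed
  then show False using separated[OF S(1) mu(1) valid_n] by blast
qed

section \<open>Mixtures with a hidden direction\<close>

lemma cube_exp_fourier_walsh:
  assumes "finite I" "V \<subseteq> I"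
  shows "cube_exp I (fourier \<rho> V) = \<rho> 0"
    and "p \<in> I \<Longrightarrow> cube_exp I (\<lambda>A. fourier \<rho> V A * sg A p) = (if p \<in> V then \<rho> 1 else 0)"
proof -
  have "cube_exp I (\<lambda>A. fourier \<rho> V A * fourier (\<lambda>_. 1) {} A) = \<rho> 0"
    using assms by (subst cube_exp_fourier_mult) auto
  moreover have "fourier (\<lambda>_. 1) {} A = 1" for A :: "'a set" by (simp add: fourier_def)
  ultimately show "cube_exp I (fourier \<rho> V) = \<rho> 0" by simp
  \<comment> \<open>Keeps level 1 only, so the expansion over \<open>{p}\<close> is the single sign
    at \<open>p\<close>.\<close>
  let ?\<theta> = "\<lambda>n :: nat. if n = 1 then 1 else 0 :: real"
  have "fourier ?\<theta> {p} A = sg A p" for A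
    by (simp add: fourier_def Pow_insert)
  moreover assume "p \<in> I"
  then have "cube_exp I (\<lambda>A. fourier \<rho> V A * fourier ?\<theta> {p} A) = (if p \<in> V then \<rho> 1 else 0)"
    using assms by (subst cube_exp_fourier_mult) (auto simp: Pow_insert)
  ultimately show "cube_exp I (\<lambda>A. fourier \<rho> V A * sg A p) = (if p \<in> V then \<rho> 1 else 0)"
    by simp
qed

lemma cube_exp_sg: "finite I \<Longrightarrow> p \<in> I \<Longrightarrow> cube_exp I (\<lambda>A. sg A p) = 0"
  using cube_exp_walsh_mult[of I "{}" "{p}"] by simp

text \<open>With inliers and outliers both uniform, the reference law is an admissible input with
  mean 0.\<close>

lemma uniform_cube_law:
  assumes "N \<ge> 1" "t \<ge> 1"
  shows "mean_vec d (cube_law d N (\<lambda>_. 1)) = (\<lambda>_. 0)"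
    and "class_P 8 8 2 d k t (cube_law d N (\<lambda>_. 1))"
    and "distr_on d (cube_law d N (\<lambda>_. 1))"
    and "0 \<le> eps \<Longrightarrow> eps \<le> 1 \<Longrightarrow>
      mixture eps (cube_law d N (\<lambda>_. 1)) (cube_law d N (\<lambda>_. 1)) = cube_law d N (\<lambda>_. 1)"
proof -
  have "mean_vec d (cube_law d N (\<lambda>_. 1)) i = 0" for i
    by (cases "i < d") (simp_all add: mean_vec_cube_law cube_exp_sg, simp add: mean_vec_def)
  then show mean: "mean_vec d (cube_law d N (\<lambda>_. 1)) = (\<lambda>_. 0)" by auto
  show "class_P 8 8 2 d k t (cube_law d N (\<lambda>_. 1))"
    using assms by (intro class_P_cube_law) (simp_all add: mean cube_exp_const vnorm_def)
  show "distr_on d (cube_law d N (\<lambda>_. 1))"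
    by (intro distr_on_cube_law) (simp_all add: cube_exp_const)
  show "mixture eps (cube_law d N (\<lambda>_. 1)) (cube_law d N (\<lambda>_. 1)) = cube_law d N (\<lambda>_. 1)"
    if "0 \<le> eps" "eps \<le> 1"
    using that by (subst mixture_cube_law) auto
qed

text \<open>The assumptions on \<open>\<rho>\<close> and \<open>\<beta>\<close> are the conclusions
  of \<open>moment_matching_coefficients\<close> for \<open>n = k * N\<close>. The dimension and the
  hidden set vary inside the locale.\<close>

locale hidden_direction =
  fixes k t N :: nat and eps z :: real and \<rho> \<beta> :: "nat \<Rightarrow> real"
  assumes k: "k \<ge> 1" and t: "t \<ge> 1" and N: "N \<ge> 1" and eps: "0 < eps" "eps \<le> 1 / 100"
    and z: "0 \<le> z" "eps * z \<le> 1 / 2"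
    and \<rho>0: "\<rho> 0 = - eps" and \<rho>1: "\<rho> 1 = - eps * z / sqrt (real (k * N))" and \<beta>0: "\<beta> 0 = 1"
    and match: "\<And>j. j \<le> t \<Longrightarrow> \<rho> j + eps * \<beta> j = 0"
    and \<rho>_le: "\<And>V A :: (nat \<times> nat) set. finite V \<Longrightarrow> card V = k * N \<Longrightarrow> \<bar>fourier \<rho> V A\<bar> \<le> 1 / 2"
    and \<beta>_ge: "\<And>V A :: (nat \<times> nat) set. finite V \<Longrightarrow> card V = k * N \<Longrightarrow> 0 \<le> fourier \<beta> V A"
    and \<beta>_le: "\<And>I V :: (nat \<times> nat) set. finite I \<Longrightarrow> V \<subseteq> I \<Longrightarrow> card V = k * N \<Longrightarrow>
      cube_exp I (\<lambda>A. (fourier \<beta> V A)\<^sup>2) \<le> exp (z\<^sup>2)"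
begin

text \<open>Dividing by \<open>1 - eps\<close> normalizes, as
  \<open>\<rho> 0 = - eps\<close>.\<close>

definition inlier_density :: "nat set \<Rightarrow> (nat \<times> nat) set \<Rightarrow> real" where
  "inlier_density S A = (1 + fourier \<rho> (S \<times> {..<N}) A) / (1 - eps)"

text \<open>The density of the mixture minus 1; its coefficients vanish up to level \<open>t\<close>
  by \<open>match\<close>.\<close>

definition perturbation :: "nat set \<Rightarrow> (nat \<times> nat) set \<Rightarrow> real" where
  "perturbation S = fourier (\<lambda>j. \<rho> j + eps * \<beta> j) (S \<times> {..<N})"

lemma perturbation_eq:
  "perturbation S A = fourier \<rho> (S \<times> {..<N}) A + eps * fourier \<beta> (S \<times> {..<N}) A"
  by (simp add: perturbation_def fourier_def distrib_right sum.distrib sum_distrib_left mult.assoc)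

context
  fixes d :: nat and S :: "nat set"
  assumes S: "S \<subseteq> {..<d}" "card S = k"
begin

lemma block: "finite (S \<times> {..<N})" "card (S \<times> {..<N}) = k * N" "S \<times> {..<N} \<subseteq> cube_index d N"
  using S finite_subset[OF S(1)] by auto

lemma inlier_density_bounds: "0 \<le> inlier_density S A" "inlier_density S A \<le> 2"
  using \<rho>_le[OF block(1,2), of A] eps by (auto simp: inlier_density_def field_simps abs_le_iff)

lemma inlier_density_mass: "cube_exp (cube_index d N) (inlier_density S) = 1"
proof -
  have "cube_exp (cube_index d N) (inlier_density S) =
      cube_exp (cube_index d N) (\<lambda>A. (1 / (1 - eps)) * (1 + fourier \<rho> (S \<times> {..<N}) A))"
    by (simp add: inlier_density_def[abs_def])
  also have "\<dots> = (1 / (1 - eps)) * (1 + \<rho> 0)"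
    unfolding cube_exp_scale cube_exp_add using block
    by (simp add: cube_exp_const cube_exp_fourier_walsh(1))
  finally show ?thesis using eps \<rho>0 by simp
qed

text \<open>The sign is negative because level 1 of the inliers cancels that of the outliers.
  \<open>N\<close> cancels between the scaling and \<open>\<rho> 1\<close>.\<close>

lemma mean_inlier:
  "mean_vec d (cube_law d N (inlier_density S)) i =
    (if i \<in> S then - (eps * z / (1 - eps)) / sqrt (real k) else 0)"
proof (cases "i < d")
  case False
  then show ?thesis using S by (auto simp: mean_vec_def)
next
  case True
  have "cube_exp (cube_index d N) (\<lambda>A. inlier_density S A * sg A (i, j)) =
      (if i \<in> S then \<rho> 1 else 0) / (1 - eps)" if "j < N" for j
  proof -
    have "cube_exp (cube_index d N) (\<lambda>A. inlier_density S A * sg A (i, j)) =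
        cube_exp (cube_index d N) (\<lambda>A. (1 / (1 - eps)) *
          (sg A (i, j) + fourier \<rho> (S \<times> {..<N}) A * sg A (i, j)))"
      by (simp add: inlier_density_def distrib_right)
    also have "\<dots> = (1 / (1 - eps)) * (0 + (if i \<in> S then \<rho> 1 else 0))"
      unfolding cube_exp_scale cube_exp_add using block True that
      by (simp add: cube_exp_sg cube_exp_fourier_walsh(2))
    finally show ?thesis by simp
  qed
  then have mean: "mean_vec d (cube_law d N (inlier_density S)) i =
      real N * ((if i \<in> S then \<rho> 1 else 0) / (1 - eps)) / sqrt (real N)"
    using True inlier_density_bounds by (simp add: mean_vec_cube_law)
  have "real N * (- a / (sqrt (real k) * sqrt (real N)) / q) / sqrt (real N) =
      - (a / q) / sqrt (real k)" for a q
    using N k by (simp add: divide_simps)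
  from this[of "eps * z" "1 - eps"] show ?thesis
    unfolding mean \<rho>1 of_nat_mult real_sqrt_mult by simp
qed

lemma vnorm_mean_inlier:
  "vnorm d (mean_vec d (cube_law d N (inlier_density S))) = eps * z / (1 - eps)"
proof -
  let ?a = "eps * z / (1 - eps)"
  have "(\<Sum>i<d. (mean_vec d (cube_law d N (inlier_density S)) i)\<^sup>2) =
      (\<Sum>i\<in>S. (?a / sqrt (real k))\<^sup>2)"
    unfolding mean_inlier using S(1) by (intro sum.mono_neutral_cong_right) (auto simp: power_divide)
  also have "\<dots> = ?a\<^sup>2"
  proof -
    have "real k * (a / sqrt (real k))\<^sup>2 = a\<^sup>2" for a
      using k by (simp add: power_divide)
    then show ?thesis unfolding sum_constant S(2) .
  qed
  finally show ?thesis using eps z by (simp add: vnorm_def)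
qed

lemma class_P_inlier: "class_P 8 8 2 d k t (cube_law d N (inlier_density S))"
proof (rule class_P_cube_law[OF N t])
  have "eps * z \<le> 1 - eps" using eps z by linarith
  then show "vnorm d (mean_vec d (cube_law d N (inlier_density S))) \<le> 1"
    unfolding vnorm_mean_inlier using eps by simp
  have "card {i. i < d \<and> mean_vec d (cube_law d N (inlier_density S)) i \<noteq> 0} \<le> card S"
    using finite_subset[OF S(1)] by (intro card_mono) (auto simp: mean_inlier split: if_splits)
  then show "card {i. i < d \<and> mean_vec d (cube_law d N (inlier_density S)) i \<noteq> 0} \<le> k"
    using S(2) by simp
qed (use inlier_density_bounds inlier_density_mass in auto)

lemma distr_on_outlier: "distr_on d (cube_law d N (fourier \<beta> (S \<times> {..<N})))"
  using \<beta>_ge block \<beta>0 by (intro distr_on_cube_law) (auto simp: cube_exp_fourier_walsh(1))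

lemma mixture_hidden:
  "mixture eps (cube_law d N (inlier_density S)) (cube_law d N (fourier \<beta> (S \<times> {..<N}))) =
    cube_law d N (\<lambda>A. 1 + perturbation S A)"
proof -
  have "mixture eps (cube_law d N (inlier_density S)) (cube_law d N (fourier \<beta> (S \<times> {..<N}))) =
    cube_law d N (\<lambda>A. (1 - eps) * inlier_density S A + eps * fourier \<beta> (S \<times> {..<N}) A)"
    using inlier_density_bounds \<beta>_ge[OF block(1,2)] eps by (intro mixture_cube_law) auto
  also have "(\<lambda>A. (1 - eps) * inlier_density S A + eps * fourier \<beta> (S \<times> {..<N}) A) =
      (\<lambda>A. 1 + perturbation S A)"
    using eps by (auto simp: inlier_density_def perturbation_eq)
  finally show ?thesis .
qed

lemma hidden_density_nonneg: "0 \<le> 1 + perturbation S A"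
proof -
  have "0 \<le> eps * fourier \<beta> (S \<times> {..<N}) A"
    using \<beta>_ge[OF block(1,2)] eps by simp
  then show ?thesis
    using \<rho>_le[OF block(1,2), of A] by (simp add: perturbation_eq abs_le_iff)
qed

lemma integral_hidden_diff:
  assumes "f \<in> borel_measurable (Rd d)"
  shows "(\<integral>x. f x \<partial>cube_law d N (\<lambda>_. 1)) - (\<integral>x. f x \<partial>cube_law d N (\<lambda>A. 1 + perturbation S A)) =
    - cube_exp (cube_index d N) (\<lambda>A. f (coord_map d N A) * perturbation S A)"
proof -
  have "(\<integral>x. f x \<partial>cube_law d N (\<lambda>A. 1 + perturbation S A)) =
      cube_exp (cube_index d N) (\<lambda>A. 1 * f (coord_map d N A) + f (coord_map d N A) * perturbation S A)"
    using hidden_density_nonneg assms by (simp add: integral_cube_law algebra_simps)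
  then show ?thesis using assms by (simp add: integral_cube_law cube_exp_add)
qed

text \<open>The square of a sum is at most twice the sum of squares; the correction is bounded
  pointwise and the outlier density in second moment.\<close>

lemma perturbation_square_le: "cube_exp (cube_index d N) (\<lambda>A. (perturbation S A)\<^sup>2) \<le> 1 / 2 + 2 * exp (z\<^sup>2)"
proof -
  have "cube_exp (cube_index d N) (\<lambda>A. (perturbation S A)\<^sup>2) \<le>
      cube_exp (cube_index d N) (\<lambda>A. 1 / 2 + 2 * (fourier \<beta> (S \<times> {..<N}) A)\<^sup>2)"
  proof (rule cube_exp_mono)
    fix A
    let ?r = "fourier \<rho> (S \<times> {..<N}) A" and ?b = "fourier \<beta> (S \<times> {..<N}) A"
    have "?r\<^sup>2 \<le> (1 / 2)\<^sup>2"
      using \<rho>_le[OF block(1,2), of A] by (intro power2_le_iff_abs_le[THEN iffD2]) auto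
    moreover have "eps\<^sup>2 * ?b\<^sup>2 \<le> 1 * ?b\<^sup>2"
      using eps by (intro mult_right_mono) (auto simp: power_le_one)
    moreover have "0 \<le> (?r - eps * ?b)\<^sup>2" by simp
    then have "(?r + eps * ?b)\<^sup>2 \<le> 2 * ?r\<^sup>2 + 2 * (eps\<^sup>2 * ?b\<^sup>2)"
      by (simp add: power2_eq_square algebra_simps)
    ultimately show "(perturbation S A)\<^sup>2 \<le> 1 / 2 + 2 * ?b\<^sup>2"
      unfolding perturbation_eq by (simp add: power2_eq_square)
  qed
  also have "\<dots> = 1 / 2 + 2 * cube_exp (cube_index d N) (\<lambda>A. (fourier \<beta> (S \<times> {..<N}) A)\<^sup>2)"
    unfolding cube_exp_add cube_exp_scale by (simp add: cube_exp_const)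
  also have "\<dots> \<le> 1 / 2 + 2 * exp (z\<^sup>2)"
    using \<beta>_le[OF _ block(3,2)] by simp
  finally show ?thesis .
qed

end

text \<open>Levels up to \<open>t\<close> vanish, so the correlation bound applies with
  \<open>s = t + 1\<close> and overlap ratio \<open>r\<close>.\<close>

lemma perturbation_correlation_le:
  assumes "S \<subseteq> {..<d}" "card S = k" "T \<subseteq> {..<d}" "card T = k"
    and "real (card (S \<inter> T)) \<le> r * real k"
  shows "\<bar>cube_exp (cube_index d N) (\<lambda>A. perturbation S A * perturbation T A)\<bar> \<le>
    r ^ (t + 1) * (1 / 2 + 2 * exp (z\<^sup>2))"
proof -
  have "0 \<le> r * real k" using assms(5) by (rule order_trans[rotated]) simp
  then have r: "0 \<le> r" using k by (simp add: zero_le_mult_iff)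
  have "S \<times> {..<N} \<inter> T \<times> {..<N} = (S \<inter> T) \<times> {..<N}" by auto
  then have "real (card (S \<times> {..<N} \<inter> T \<times> {..<N})) \<le> r * real (card (S \<times> {..<N}))"
    using assms(2,5) mult_right_mono[OF assms(5), of "real N"] by (simp add: card_cartesian_product mult_ac)
  then have "\<bar>cube_exp (cube_index d N) (\<lambda>A. perturbation S A * perturbation T A)\<bar> \<le>
      r ^ (t + 1) * cube_exp (cube_index d N) (\<lambda>A. (perturbation S A)\<^sup>2)"
    unfolding perturbation_def using assms match
    by (intro cube_exp_fourier_correlation) auto
  also have "\<dots> \<le> r ^ (t + 1) * (1 / 2 + 2 * exp (z\<^sup>2))"
    using r assms(1,2) by (intro mult_left_mono perturbation_square_le) auto
  finally show ?thesis .
qed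

end

section \<open>The lower bound\<close>

text \<open>The bound on \<open>C\<close> enters here: \<open>\<epsilon> (z t)\<^sup>t\<close> is essentially \<open>(4 C)\<^sup>t\<close>.\<close>
lemma outlier_shift_bounds:
  fixes eps C delta z :: real
  assumes t: "t \<ge> 1" and eps: "0 < eps" "eps \<le> (100 * real t) powr (- real t)"
    and C: "0 \<le> C" "C < 1 / 2000" and delta: "delta = C * eps powr (1 - 1 / real t) / real t"
    and z: "z = 1 + 4 * delta / eps"
  shows "eps \<le> 1 / 100" "0 \<le> delta" "eps * z \<le> 1 / 2" "2 * delta < eps * z" "0 \<le> z"
    "eps * (real t + 1) * ((z + 1) * real t) ^ t \<le> 1 / 4"
proof -
  \<comment> \<open>With this \<open>t\<close>-th root the smallness assumption reads
    \<open>y * t \<le> 1 / 100\<close>, and \<open>eps\<close> can be moved inside the power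
    \<open>t\<close>.\<close>
  define y where "y = eps powr (1 / real t)"
  have y_pos: "y > 0" using eps by (simp add: y_def)
  have "y \<le> ((100 * real t) powr (- real t)) powr (1 / real t)"
    unfolding y_def using eps by (intro powr_mono2) auto
  also have "\<dots> = 1 / (100 * real t)"
  proof -
    have "((100 * real t) powr (- real t)) powr (1 / real t) = (100 * real t) powr (-1)"
      unfolding powr_powr using t by simp
    then show ?thesis using t by (simp add: powr_minus_divide)
  qed
  finally have yt: "y * real t \<le> 1 / 100"
    using t by (simp add: field_simps)
  have "eps \<le> (100 * real t) powr (-1)"
  proof -
    have "(100 * real t) powr (- real t) \<le> (100 * real t) powr (-1)"
      using t by (intro powr_mono) auto
    then show ?thesis using eps(2) by linarith
  qed
  also have "\<dots> \<le> 1 / 100"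
    using t by (simp add: powr_minus_divide field_simps)
  finally show eps100: "eps \<le> 1 / 100" .
  have y_pow: "y ^ t = eps"
    using t eps by (simp add: y_def powr_power)
  have delta_y: "delta = C * (eps / y) / real t"
    using eps by (simp add: delta y_def powr_diff)
  show delta0: "0 \<le> delta" using C eps by (simp add: delta)
  have "eps powr (1 - 1 / real t) \<le> 1"
    using eps eps100 t by (intro powr_le1) auto
  then have "C * eps powr (1 - 1 / real t) / real t \<le> C * 1 / 1"
    using C t by (intro frac_le mult_left_mono) auto
  then have "delta \<le> C" by (simp add: delta)
  \<comment> \<open>The summand 1 of \<open>z\<close> yields the extra \<open>eps\<close>, which
    keeps the separation strict even for \<open>delta = 0\<close>.\<close>
  moreover have ez: "eps * z = eps + 4 * delta" using eps by (simp add: z field_simps)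
  ultimately show "eps * z \<le> 1 / 2" "2 * delta < eps * z"
    using C eps eps100 delta0 by linarith+
  show "0 \<le> z" using delta0 eps by (simp add: z)
  have "eps * ((z + 1) * real t) ^ t = (y * ((z + 1) * real t)) ^ t"
    by (simp only: power_mult_distrib[of y] y_pow)
  \<comment> \<open>\<open>delta\<close> is scaled so that \<open>4 * delta / eps\<close>
    contributes exactly \<open>4 * C\<close>; the total is below \<open>1 / 40\<close>.\<close>
  also have "y * ((z + 1) * real t) = 2 * (y * real t) + 4 * C"
    using y_pos eps t by (simp add: z delta_y field_simps)
  also have "(2 * (y * real t) + 4 * C) ^ t \<le> (1 / 40) ^ t"
    using yt C y_pos by (intro power_mono) auto
  finally have pow: "eps * ((z + 1) * real t) ^ t \<le> (1 / 40) ^ t" .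
  \<comment> \<open>The number of nodes is absorbed by \<open>2 ^ t\<close>, leaving
    \<open>(1 / 20) ^ t\<close>.\<close>
  have "real t + 1 \<le> 2 ^ t"
    using Bernoulli_inequality[of "1 :: real" t] by simp
  then have "(real t + 1) * (eps * ((z + 1) * real t) ^ t) \<le> 2 ^ t * (1 / 40) ^ t"
    using pow eps \<open>0 \<le> z\<close> by (intro mult_mono) auto
  also have "\<dots> = (1 / 20) ^ t" by (simp flip: power_mult_distrib)
  also have "\<dots> \<le> (1 / 20) ^ 1" using t by (intro power_decreasing) auto
  finally show "eps * (real t + 1) * ((z + 1) * real t) ^ t \<le> 1 / 4" by (simp add: mult_ac)
qed

context hidden_direction
begin

text \<open>The number \<open>n\<close> of detected sets satisfies
  \<open>n * tau^2 \<le> X + n * \<kappa> * X\<close> by the correlation bounds. As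
  \<open>tau^2\<close> is at least \<open>10 * \<kappa> * X\<close>, this leaves
  \<open>9 * n * \<kappa> \<le> 1\<close>.\<close>

lemma card_detected_le:
  assumes F: "finite F" "\<And>S. S \<in> F \<Longrightarrow> S \<subseteq> {..<d} \<and> card S = k"
    and inter: "\<And>S T. S \<in> F \<Longrightarrow> T \<in> F \<Longrightarrow> S \<noteq> T \<Longrightarrow> real (card (S \<inter> T)) \<le> r * real k"
    and f: "f \<in> borel_measurable (Rd d)" "\<And>x. x \<in> space (Rd d) \<Longrightarrow> \<bar>f x\<bar> \<le> 1"
    and r: "0 < r" "0 \<le> tau" and tau: "10 * r ^ (t + 1) * (1 / 2 + 2 * exp (z\<^sup>2)) \<le> tau\<^sup>2"
  shows "real (card {S \<in> F. tau < \<bar>(\<integral>x. f x \<partial>cube_law d N (\<lambda>_. 1)) -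
    (\<integral>x. f x \<partial>cube_law d N (\<lambda>A. 1 + perturbation S A))\<bar>}) \<le> 1 / (9 * r ^ (t + 1))"
proof -
  let ?I = "cube_index d N" and ?X = "1 / 2 + 2 * exp (z\<^sup>2)" and ?\<kappa> = "r ^ (t + 1)"
  define G where "G = {S \<in> F. tau < \<bar>(\<integral>x. f x \<partial>cube_law d N (\<lambda>_. 1)) -
    (\<integral>x. f x \<partial>cube_law d N (\<lambda>A. 1 + perturbation S A))\<bar>}"
  let ?n = "real (card G)"
  have X: "?X > 0" by (simp add: add_pos_pos)
  have \<kappa>: "?\<kappa> > 0" using r by simp
  have "?n * tau\<^sup>2 \<le> ?X + ?n * (?\<kappa> * ?X)"
  proof (rule card_correlated_le[where I = ?I and f = "\<lambda>A. f (coord_map d N A)" and h = perturbation])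
    show "cube_exp ?I (\<lambda>A. (perturbation S A)\<^sup>2) \<le> ?X" if "S \<in> G" for S
      using that F by (intro perturbation_square_le) (auto simp: G_def)
    show "\<bar>cube_exp ?I (\<lambda>A. perturbation S A * perturbation T A)\<bar> \<le> ?\<kappa> * ?X"
      if "S \<in> G" "T \<in> G" "S \<noteq> T" for S T
      using that F inter by (intro perturbation_correlation_le) (auto simp: G_def)
    show "tau \<le> \<bar>cube_exp ?I (\<lambda>A. f (coord_map d N A) * perturbation S A)\<bar>" if "S \<in> G" for S
      using that F integral_hidden_diff[where S = S and f = f] f(1) by (auto simp: G_def)
    show "\<bar>f (coord_map d N A)\<bar> \<le> 1" for A
      using f(2) coord_map_in_space by blast
  qed (use F X \<kappa> r in \<open>auto simp: G_def\<close>)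
  moreover have "?n * (10 * ?\<kappa> * ?X) \<le> ?n * tau\<^sup>2"
    using tau by (intro mult_left_mono) auto
  ultimately have "(?n * (9 * ?\<kappa>)) * ?X \<le> 1 * ?X"
    by (simp add: algebra_simps)
  then have "?n * (9 * ?\<kappa>) \<le> 1"
    using X by (simp only: mult_le_cancel_right_pos)
  then show ?thesis using \<kappa> unfolding G_def[symmetric] by (simp only: pos_le_divide_eq mult_pos_pos zero_less_numeral)
qed

end

lemma hidden_direction_exists:
  fixes eps z :: real
  assumes "k \<ge> 1" "t \<ge> 1" "0 < eps" "eps \<le> 1 / 100" "0 \<le> z" "eps * z \<le> 1 / 2"
    and "eps * (real t + 1) * ((z + 1) * real t) ^ t \<le> 1 / 4"
  obtains N \<rho> \<beta> where "hidden_direction k t N eps z \<rho> \<beta>"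
proof -
  \<comment> \<open>Large enough for the outlier density to be nonnegative.\<close>
  define N where "N = nat \<lceil>z\<^sup>2\<rceil> + 1"
  have N: "N \<ge> 1" "z\<^sup>2 \<le> real N" by (simp_all add: N_def) linarith
  have "real N \<le> real k * real N"
    using assms(1) mult_right_mono[of 1 "real k" "real N"] by simp
  then have kN: "k * N \<ge> 1" "z\<^sup>2 \<le> real (k * N)" using N assms(1) by (auto intro: order_trans)
  show ?thesis
  proof (rule moment_matching_coefficients[OF assms(2,5,3) kN assms(7), where 'i = "nat \<times> nat"])
    fix \<rho> \<beta> :: "nat \<Rightarrow> real"
    assume "\<rho> 0 = - eps" "\<rho> 1 = - eps * z / sqrt (real (k * N))" "\<beta> 0 = 1"
      "\<And>j. j \<le> t \<Longrightarrow> \<rho> j + eps * \<beta> j = 0"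
      "\<And>V A :: (nat \<times> nat) set. finite V \<Longrightarrow> card V = k * N \<Longrightarrow> \<bar>fourier \<rho> V A\<bar> \<le> 1 / 2"
      "\<And>V A :: (nat \<times> nat) set. finite V \<Longrightarrow> card V = k * N \<Longrightarrow> 0 \<le> fourier \<beta> V A"
      "\<And>I V :: (nat \<times> nat) set. finite I \<Longrightarrow> V \<subseteq> I \<Longrightarrow> card V = k * N \<Longrightarrow>
        cube_exp I (\<lambda>A. (fourier \<beta> V A)\<^sup>2) \<le> exp (z\<^sup>2)"
    then have "hidden_direction k t N eps z \<rho> \<beta>"
      using assms N(1) by (intro hidden_direction.intro)
    then show ?thesis by (rule that)
  qed
qed

text \<open>From \<open>(1 + 4 w)^2 \<le> 2 + 32 w^2\<close> for \<open>w = delta / eps\<close> and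
  \<open>exp 2 \<le> 9\<close>, the second moment is at most \<open>20 * exp (32 * w^2)\<close>;
  then \<open>10 * 20 = 25 * 4 * 2\<close>, with \<open>2 \<le> 2 ^ t\<close>.\<close>

lemma tolerance_square_bound:
  fixes eps delta c z T :: real
  assumes k: "k \<ge> 1" "t \<ge> 1" and z: "z = 1 + 4 * delta / eps"
    and T: "T = 5 * real k powr (- (real t + 1) * (1 / 2 - c / 2)) * 2 powr (real t / 2 + 1) *
      exp (16 * delta\<^sup>2 / eps\<^sup>2)"
  shows "10 * (real k powr (c - 1)) ^ (t + 1) * (1 / 2 + 2 * exp (z\<^sup>2)) \<le> T\<^sup>2"
proof -
  define u where "u = delta\<^sup>2 / eps\<^sup>2"
  let ?\<kappa> = "(real k powr (c - 1)) ^ (t + 1)"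
  have \<kappa>: "(real k powr (- (real t + 1) * (1 / 2 - c / 2)))\<^sup>2 = ?\<kappa>"
  proof -
    have "(real k powr (- (real t + 1) * (1 / 2 - c / 2)))\<^sup>2 =
        real k powr (real 2 * (- (real t + 1) * (1 / 2 - c / 2)))"
      using k by (intro powr_power) auto
    also have "real 2 * (- (real t + 1) * (1 / 2 - c / 2)) = real (t + 1) * (c - 1)"
      by (simp add: field_simps)
    also have "real k powr \<dots> = ?\<kappa>"
      using k by (intro powr_power[symmetric]) auto
    finally show ?thesis .
  qed
  have pow2: "(2 powr (real t / 2 + 1))\<^sup>2 = (4 :: real) * 2 ^ t"
    by (simp add: powr_power powr_add algebra_simps powr_realpow)
  have T2: "T\<^sup>2 = 25 * ?\<kappa> * (4 * 2 ^ t) * exp (32 * u)"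
    unfolding T power_mult_distrib \<kappa> pow2 u_def by (simp flip: exp_of_nat_mult exp_double)
  have "z\<^sup>2 \<le> 2 + 32 * u"
  proof -
    define w where "w = delta / eps"
    have "0 \<le> (1 - 4 * w)\<^sup>2" by simp
    then have "(1 + 4 * w)\<^sup>2 \<le> 2 + 32 * w\<^sup>2" by (simp add: power2_eq_square algebra_simps)
    then show ?thesis by (simp add: z u_def w_def power_divide)
  qed
  then have "exp (z\<^sup>2) \<le> exp 2 * exp (32 * u)" by (simp flip: exp_add)
  also have "exp (2 :: real) = (exp 1)\<^sup>2" by (simp flip: exp_double)
  also have "(exp (1 :: real))\<^sup>2 \<le> 3\<^sup>2" by (intro power_mono exp_le) simp
  finally have "exp (z\<^sup>2) \<le> 9 * exp (32 * u)" by simp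
  moreover have "1 \<le> exp (32 * u)" by (simp add: u_def)
  ultimately have "1 / 2 + 2 * exp (z\<^sup>2) \<le> 20 * exp (32 * u)" by linarith
  then have "10 * ?\<kappa> * (1 / 2 + 2 * exp (z\<^sup>2)) \<le> 10 * ?\<kappa> * (20 * exp (32 * u))"
    by (intro mult_left_mono) auto
  also have "\<dots> = 25 * ?\<kappa> * (4 * 2) * exp (32 * u)" by simp
  also have "\<dots> \<le> 25 * ?\<kappa> * (4 * 2 ^ t) * exp (32 * u)"
    using k(2) self_le_power[of "2 :: real" t] by (intro mult_left_mono mult_right_mono) auto
  finally show ?thesis unfolding T2 .
qed

theorem theorem6p13:
  shows "\<exists>cp C0 Dg C1 K1 K2 K3.
    cp > 0 \<and> C0 > 0 \<and> Dg > 0 \<and> C1 > 0 \<and> K1 > 0 \<and> K2 > 0 \<and> K3 > 0 \<and>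
    (\<forall>(d::nat) (k::nat) (t::nat) (eps::real) (C::real) (c::real) (delta::real) (A::sq_alg).
       d \<ge> 1 \<longrightarrow> k \<ge> 1 \<longrightarrow> t \<ge> 1 \<longrightarrow> real k \<le> sqrt (real d) \<longrightarrow>
       0 < eps \<longrightarrow> eps \<le> (C1 * real t) powr (- real t) \<longrightarrow>
       0 \<le> C \<longrightarrow> C < 1 / 2000 \<longrightarrow> 0 < c \<longrightarrow> c < 1 \<longrightarrow>
       delta = C * eps powr (1 - 1 / real t) / real t \<longrightarrow>
       wf_sq_alg d A \<longrightarrow>
       solves cp C0 Dg d k t eps delta A \<longrightarrow>
       ((\<exists>P B hs. class_P cp C0 Dg d k t P \<and> distr_on d B \<and>
           valid_run A (mixture eps P B) hs \<and>
           real (length hs) \<ge> K1 * real d powr (c * real k powr c / 8)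
                                 * real k powr (- (real t + 1) * (1 - c)))
        \<or>
        (\<exists>P B hs f tau. class_P cp C0 Dg d k t P \<and> distr_on d B \<and>
           valid_run A (mixture eps P B) hs \<and> A hs = Query f tau \<and>
           tau \<le> K2 * real k powr (- (real t + 1) * (1 / 2 - c / 2))
                   * 2 powr (real t / 2 + 1) * exp (K3 * delta\<^sup>2 / eps\<^sup>2))))"
\<comment> \<open>8, 8 and 2 come from \<open>class_P_cube_law\<close>, 100 from
  \<open>outlier_shift_bounds\<close>, 5 and 16 from \<open>tolerance_square_bound\<close>. The
  query constant 1 works since \<open>card_detected_le\<close> leaves a factor 9 to spare.\<close>
proof (rule exI[of _ 8], rule exI[of _ 8], rule exI[of _ 2], rule exI[of _ 100], rule exI[of _ 1],
    rule exI[of _ 5], rule exI[of _ 16], intro conjI allI impI)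
  fix d k t :: nat and eps C c delta :: real and A :: sq_alg
  assume d: "d \<ge> 1" and k: "k \<ge> 1" and t: "t \<ge> 1" and kd: "real k \<le> sqrt (real d)"
    and eps: "0 < eps" "eps \<le> (100 * real t) powr (- real t)"
    and C: "0 \<le> C" "C < 1 / 2000" and c: "0 < c" "c < 1"
    and delta: "delta = C * eps powr (1 - 1 / real t) / real t"
    and wf: "wf_sq_alg d A" and solves: "solves 8 8 2 d k t eps delta A"
  define z where "z = 1 + 4 * delta / eps"
  note bounds = outlier_shift_bounds[OF t eps C delta z_def]
  obtain N \<rho> \<beta> where "hidden_direction k t N eps z \<rho> \<beta>"
    using hidden_direction_exists[OF k t eps(1) bounds(1,5,3,6)] by blast
  then interpret hidden_direction k t N eps z \<rho> \<beta> .
  obtain F where F: "finite F" "\<And>S. S \<in> F \<Longrightarrow> S \<subseteq> {..<d}" "\<And>S. S \<in> F \<Longrightarrow> card S = k"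
    "\<And>S T. S \<in> F \<Longrightarrow> T \<in> F \<Longrightarrow> S \<noteq> T \<Longrightarrow> real (card (S \<inter> T)) \<le> real k powr c"
    "real d powr (c * real k powr c / 8) \<le> real (card F)"
    using exists_sparse_family[OF k kd c] by blast
  define r where "r = real k powr (c - 1)"
  define T where "T = 5 * real k powr (- (real t + 1) * (1 / 2 - c / 2)) * 2 powr (real t / 2 + 1) *
    exp (16 * delta\<^sup>2 / eps\<^sup>2)"
  define U where "U = cube_law d N (\<lambda>_. 1)"
  define D where "D S = cube_law d N (\<lambda>A. 1 + perturbation S A)" for S
  have r_pos: "r > 0" using k by (simp add: r_def)
  have T_pos: "T > 0" using k by (simp add: T_def)
  have rk: "r * real k = real k powr c"
    using k by (simp add: r_def powr_diff)
  have r_pow: "r ^ (t + 1) = real k powr (- (real t + 1) * (1 - c))"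
  proof -
    have "r ^ (t + 1) = real k powr (real (t + 1) * (c - 1))"
      unfolding r_def using k by (intro powr_power) auto
    also have "real (t + 1) * (c - 1) = - (real t + 1) * (1 - c)"
      by (simp add: algebra_simps)
    finally show ?thesis .
  qed
  let ?B = "1 * real d powr (c * real k powr c / 8) * real k powr (- (real t + 1) * (1 - c))"
  have eps1: "0 \<le> eps" "eps \<le> 1" using eps(1) bounds(1) by auto
  note U = uniform_cube_law[OF N t, where d = d, folded U_def]
  have mix_U: "mixture eps U U = U" using U(4) eps1 .
  have "(\<exists>hs. valid_run A U hs \<and> real (length hs) \<ge> ?B) \<or>
    (\<exists>hs f tau. valid_run A U hs \<and> A hs = Query f tau \<and> tau \<le> T)"
  proof (rule sq_adversary[OF wf F(1), where D = D and \<eta> = "1 / (9 * r ^ (t + 1))"])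
    \<comment> \<open>The whole query budget rules out at most a ninth of the lower bound on the
      family.\<close>
    have "?B * (1 / (9 * r ^ (t + 1))) = real d powr (c * real k powr c / 8) / 9"
      using r_pos unfolding r_pow[symmetric] by simp
    also have "\<dots> < real d powr (c * real k powr c / 8)" using d by simp
    finally show "?B * (1 / (9 * r ^ (t + 1))) < real (card F)" using F(5) by linarith
    fix f :: "(nat \<Rightarrow> real) \<Rightarrow> real" and tau :: real
    assume f: "f \<in> borel_measurable (Rd d)" "\<And>x. x \<in> space (Rd d) \<Longrightarrow> \<bar>f x\<bar> \<le> 1"
      and tau: "T < tau"
    have "10 * r ^ (t + 1) * (1 / 2 + 2 * exp (z\<^sup>2)) \<le> T\<^sup>2"
      unfolding r_def by (rule tolerance_square_bound[OF k t z_def T_def])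
    also have "\<dots> \<le> tau\<^sup>2" using tau T_pos by (intro power_mono) auto
    finally have tau_ge: "10 * r ^ (t + 1) * (1 / 2 + 2 * exp (z\<^sup>2)) \<le> tau\<^sup>2" .
    show "real (card {S \<in> F. tau < \<bar>(\<integral>x. f x \<partial>U) - (\<integral>x. f x \<partial>D S)\<bar>}) \<le> 1 / (9 * r ^ (t + 1))"
      unfolding U_def D_def
    proof (rule card_detected_le[OF F(1) _ _ f r_pos _ tau_ge])
      show "S \<subseteq> {..<d} \<and> card S = k" if "S \<in> F" for S
        using F(2,3)[OF that] by simp
      show "real (card (S \<inter> S')) \<le> r * real k" if "S \<in> F" "S' \<in> F" "S \<noteq> S'" for S S'
        unfolding rk using that by (rule F(4))
      show "0 \<le> tau" using T_pos tau by simp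
    qed
  next
    fix hs mu S
    assume S: "S \<in> F" and out: "A hs = Output mu"
      and valid: "valid_run A U hs" "valid_run A (D S) hs"
    note S' = F(2,3)[OF S]
    let ?P = "cube_law d N (inlier_density S)"
    \<comment> \<open>One output would have to be within \<open>delta\<close> of 0 and of a mean of
      norm above \<open>2 * delta\<close>.\<close>
    have "valid_run A (mixture eps U U) hs"
      unfolding mix_U by (rule valid(1))
    then have "vnorm d (\<lambda>i. mu i - mean_vec d U i) \<le> delta"
      using solves U(2,3) out unfolding solves_def by blast
    moreover have "valid_run A (mixture eps ?P (cube_law d N (fourier \<beta> (S \<times> {..<N})))) hs"
      unfolding mixture_hidden[OF S'] using valid(2) by (simp only: D_def)
    then have "vnorm d (\<lambda>i. mu i - mean_vec d ?P i) \<le> delta"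
      using solves class_P_inlier[OF S'] distr_on_outlier[OF S'] out unfolding solves_def by blast
    ultimately have "vnorm d (\<lambda>i. mean_vec d ?P i - mean_vec d U i) \<le> 2 * delta"
      using vnorm_triangle[of d "mean_vec d ?P" "mean_vec d U" mu] by linarith
    then have "eps * z / (1 - eps) \<le> 2 * delta"
      using vnorm_mean_inlier[OF S'] by (simp add: U(1))
    moreover have "eps * z \<le> eps * z / (1 - eps)"
      using eps1 bounds(1,5) by (simp add: le_divide_eq mult_left_le)
    ultimately show False using bounds(4) by linarith
  qed (use T_pos r_pos in auto)
  then show "(\<exists>P B hs. class_P 8 8 2 d k t P \<and> distr_on d B \<and> valid_run A (mixture eps P B) hs \<and>
      real (length hs) \<ge> ?B) \<or>
    (\<exists>P B hs f tau. class_P 8 8 2 d k t P \<and> distr_on d B \<and>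
      valid_run A (mixture eps P B) hs \<and> A hs = Query f tau \<and>
      tau \<le> 5 * real k powr (- (real t + 1) * (1 / 2 - c / 2)) * 2 powr (real t / 2 + 1) *
        exp (16 * delta\<^sup>2 / eps\<^sup>2))"
  \<comment> \<open>Both kinds of run are on \<open>U\<close>, which serves as inliers and as
    outliers.\<close>
  proof (elim disjE exE conjE)
    fix hs assume "valid_run A U hs" "real (length hs) \<ge> ?B"
    then show ?thesis
      using U(2,3) mix_U by (intro disjI1 exI[of _ U] exI[of _ hs]) auto
  next
    fix hs f tau assume "valid_run A U hs" "A hs = Query f tau" "tau \<le> T"
    then show ?thesis
      using U(2,3) mix_U unfolding T_def
      by (intro disjI2 exI[of _ U] exI[of _ hs] exI[of _ f] exI[of _ tau]) auto
  qed
qed simp_all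

end
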